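(* Let $(M,F)$ be an $n$-dimensional Finsler space with dual Cartan structure $K$, and let $L_V$ be a leaf of the vertical foliation $V$ of $\mathcal{T}M$ (with $y\neq0$, $p\neq0$), endowed with the Riemannian metric $G_{L_V}=G|_{L_V}$. Then the sectional curvature of any nondegenerate plane section on $L_V$ which contains the vertical Liouville vector field $\mathcal{E}=y^i\frac{\partial}{\partial y^i}+p_i\frac{\partial}{\partial p_i}$ is equal to zero.
   Context: Let $M$ be a smooth $n$-dimensional manifold, $TM^0$ and $T^*M^0$ its tangent and cotangent bundles with the zero sections removed. A Finsler structure on $M$ is a function $F:TM\to[0,\infty)$, smooth on $TM^0$, with $F(x,\lambda y)=\lambda F(x,y)$ for $\lambda>0$, and such that $g_{ij}(x,y)=\frac12\frac{\partial^2F^2}{\partial y^i\partial y^j}$ is positive definite on $TM^0$; $(M,F)$ is called a Finsler space. The dual Cartan structure $K:T^*M\to[0,\infty)$ is obtained from $F$ by Legendre transformation: $K(x,p)=F(x,y)$ whenever $p_i=g_{ij}(x,y)y^j$, $y\ne0$, and $K(x,0)=0$. It is smooth on $T^*M^0$, satisfies $K(x,\lambda p)=\lambda K(x,p)$ for $\lambda>0$, and $g^{*ij}(x,p)=\frac12\frac{\partial^2K^2}{\partial p_i\partial p_j}$ is positive definite on $T^*M^0$. The big-tangent manifold $\mathcal{T}M$ is the total space of $TM\oplus T^*M\to M$, a $3n$-dimensional manifold with local coordinates $(x^i,y^i,p_i)$, where $(x^i)$ are coordinates on $M$, $(y^i)$ vector coordinates and $(p_i)$ covector coordinates; we work on its open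 subset where $y\ne 0$ and $p\neq 0$. The vertical bundle $V$ (the kernel of the differential of the projection to $M$) has local frame $\{\frac{\partial}{\partial y^i},\frac{\partial}{\partial p_i}\}$. The metric $G$ on $V$ is $G(X,Y)=g_{ij}(x,y)X_1^iY_1^j+g^{*ij}(x,p)X^2_iY^2_j$ for $X=X_1^i\frac{\partial}{\partial y^i}+X^2_i\frac{\partial}{\partial p_i}$, $Y=Y_1^j\frac{\partial}{\partial y^j}+Y^2_j\frac{\partial}{\partial p_j}$ in $\Gamma(V)$. A leaf $L_V$ of $V$ is given locally by $x^i=a^i$ constant, so its tangent bundle is $V|_{L_V}$ and $G$ restricts to a Riemannian metric on it. *)

theory Defs
  imports "HOL-Analysis.Analysis"
begin

section \<open>Smooth maps and smooth manifolds\<close>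

text \<open>For open \<open>S\<close>, all iterated directional derivatives up to order \<open>k\<close> exist and are continuous
  on \<open>S\<close>; this is the usual class \<open>C\<^sup>k\<close>.\<close>

primrec Ck_on :: "nat \<Rightarrow> 'a::euclidean_space set \<Rightarrow> ('a \<Rightarrow> 'b::real_normed_vector) \<Rightarrow> bool" where
  "Ck_on 0 S f \<longleftrightarrow> continuous_on S f"
| "Ck_on (Suc k) S f \<longleftrightarrow>
     (\<forall>x\<in>S. f differentiable (at x)) \<and> (\<forall>v. Ck_on k S (\<lambda>x. frechet_derivative f (at x) v))"

definition smooth_on :: "'a::euclidean_space set \<Rightarrow> ('a \<Rightarrow> 'b::real_normed_vector) \<Rightarrow> bool" where
  "smooth_on S f \<longleftrightarrow> (\<forall>k. Ck_on k S f)"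

type_synonym ('m, 'e) chart = "'m set \<times> ('m \<Rightarrow> 'e)"

abbreviation cdom :: "('m, 'e) chart \<Rightarrow> 'm set" where "cdom \<equiv> fst"
abbreviation cmap :: "('m, 'e) chart \<Rightarrow> 'm \<Rightarrow> 'e" where "cmap \<equiv> snd"

definition transition :: "('m, 'e) chart \<Rightarrow> ('m, 'e) chart \<Rightarrow> 'e \<Rightarrow> 'e" where
  "transition c d = cmap d \<circ> inv_into (cdom c) (cmap c)"

text \<open>\<open>A\<close> is any smooth atlas; it need not be maximal, and it determines the smooth structure.\<close>

definition smooth_manifold :: "'m topology \<Rightarrow> ('m, 'e::euclidean_space) chart set \<Rightarrow> bool" where
  "smooth_manifold M A \<longleftrightarrow>
     Hausdorff_space M \<and> second_countable M \<and>
     (\<Union>c\<in>A. cdom c) = topspace M \<and>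
     (\<forall>c\<in>A. openin M (cdom c) \<and> open (cmap c ` cdom c) \<and>
        homeomorphic_map (subtopology M (cdom c)) (top_of_set (cmap c ` cdom c)) (cmap c)) \<and>
     (\<forall>c\<in>A. \<forall>d\<in>A. smooth_on (cmap c ` (cdom c \<inter> cdom d)) (transition c d))"

definition charts_at :: "('m, 'e) chart set \<Rightarrow> 'm \<Rightarrow> ('m, 'e) chart set" where
  "charts_at A x = {c \<in> A. x \<in> cdom c}"

text \<open>A tangent vector or covector at \<open>x\<close> is the family of its component vectors, indexed by the
  charts around \<open>x\<close> and subject to the respective transformation law. Families are set to \<open>0\<close> at
  all other indices, so that equality of vectors is equality of families.\<close>

type_synonym ('m, 'e) components = "('m, 'e) chart \<Rightarrow> 'e"

definition tangent_space ::
    "('m, 'e::euclidean_space) chart set \<Rightarrow> 'm \<Rightarrow> ('m, 'e) components set" where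
  "tangent_space A x = {y.
     (\<forall>c\<in>charts_at A x. \<forall>d\<in>charts_at A x.
        y d = frechet_derivative (transition c d) (at (cmap c x)) (y c)) \<and>
     (\<forall>c. c \<notin> charts_at A x \<longrightarrow> y c = 0)}"

text \<open>Covector components are defined by the invariance of the pairing
  \<open>p\<^sub>i w\<^sup>i\<close> with tangent vectors.\<close>

definition cotangent_space ::
    "('m, 'e::euclidean_space) chart set \<Rightarrow> 'm \<Rightarrow> ('m, 'e) components set" where
  "cotangent_space A x = {p.
     (\<forall>c\<in>charts_at A x. \<forall>d\<in>charts_at A x. \<forall>w.
        p c \<bullet> w = p d \<bullet> frechet_derivative (transition c d) (at (cmap c x)) w) \<and>
     (\<forall>c. c \<notin> charts_at A x \<longrightarrow> p c = 0)}"

text \<open>The tangent vector (covector) at \<open>x\<close> with prescribed components in the chart \<open>c\<close>.\<close>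

definition tangent_of ::
    "('m, 'e::euclidean_space) chart set \<Rightarrow> 'm \<Rightarrow> ('m, 'e) chart \<Rightarrow> 'e \<Rightarrow> ('m, 'e) components" where
  "tangent_of A x c = inv_into (tangent_space A x) (\<lambda>y. y c)"

definition cotangent_of ::
    "('m, 'e::euclidean_space) chart set \<Rightarrow> 'm \<Rightarrow> ('m, 'e) chart \<Rightarrow> 'e \<Rightarrow> ('m, 'e) components" where
  "cotangent_of A x c = inv_into (cotangent_space A x) (\<lambda>p. p c)"


section \<open>Finsler structures and their dual Cartan structures\<close>

text \<open>The matrix \<open>\<onehalf> \<partial>\<^sup>2f\<^sup>2/\<partial>v\<^sup>i\<partial>v\<^sup>j\<close>; it yields both \<open>g\<^sub>i\<^sub>j\<close> and \<open>g\<^sup>*\<^sup>i\<^sup>j\<close>.\<close>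

definition fundamental_matrix :: "(real^'n \<Rightarrow> real) \<Rightarrow> real^'n \<Rightarrow> real^'n^'n" where
  "fundamental_matrix f v = (\<chi> i j. 1/2 *
     frechet_derivative (\<lambda>z. frechet_derivative (\<lambda>w. (f w)\<^sup>2) (at z) (axis j 1)) (at v) (axis i 1))"

definition g_lower :: "('m, real^'n) chart set \<Rightarrow> ('m \<Rightarrow> ('m, real^'n) components \<Rightarrow> real) \<Rightarrow>
    ('m, real^'n) chart \<Rightarrow> 'm \<Rightarrow> real^'n \<Rightarrow> real^'n^'n" where
  "g_lower A F c x = fundamental_matrix (\<lambda>v. F x (tangent_of A x c v))"

definition g_star :: "('m, real^'n) chart set \<Rightarrow> ('m \<Rightarrow> ('m, real^'n) components \<Rightarrow> real) \<Rightarrow>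
    ('m, real^'n) chart \<Rightarrow> 'm \<Rightarrow> real^'n \<Rightarrow> real^'n^'n" where
  "g_star A K c x = fundamental_matrix (\<lambda>w. K x (cotangent_of A x c w))"

definition finsler_structure :: "'m topology \<Rightarrow> ('m, real^'n) chart set \<Rightarrow>
    ('m \<Rightarrow> ('m, real^'n) components \<Rightarrow> real) \<Rightarrow> bool" where
  "finsler_structure M A F \<longleftrightarrow>
     (\<forall>x\<in>topspace M. \<forall>y\<in>tangent_space A x. F x y \<ge> 0) \<and>
     (\<forall>c\<in>A. smooth_on ((cmap c ` cdom c) \<times> (- {0}))
        (\<lambda>(a, v). let x = inv_into (cdom c) (cmap c) a in F x (tangent_of A x c v))) \<and>
     (\<forall>x\<in>topspace M. \<forall>y\<in>tangent_space A x. \<forall>l>0. F x (\<lambda>c. l *\<^sub>R y c) = l * F x y) \<and>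
     (\<forall>x\<in>topspace M. \<forall>c\<in>charts_at A x. \<forall>v. v \<noteq> 0 \<longrightarrow>
        (\<forall>u. u \<noteq> 0 \<longrightarrow> u \<bullet> (g_lower A F c x v *v u) > 0))"

text \<open>The Legendre relation \<open>p\<^sub>i = g\<^sub>i\<^sub>j(x,y) y\<^sup>j\<close> does not depend on the chart and is a bijection
  between the nonzero vectors and the nonzero covectors at \<open>x\<close>, so \<open>K\<close> is determined by \<open>F\<close>. Its
  homogeneity, its smoothness off the zero section and the positive definiteness of \<open>g\<^sup>*\<^sup>i\<^sup>j\<close> are
  consequences and are not required here.\<close>

definition dual_cartan_structure :: "'m topology \<Rightarrow> ('m, real^'n) chart set \<Rightarrow>
    ('m \<Rightarrow> ('m, real^'n) components \<Rightarrow> real) \<Rightarrow> ('m \<Rightarrow> ('m, real^'n) components \<Rightarrow> real) \<Rightarrow> bool" where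
  "dual_cartan_structure M A F K \<longleftrightarrow>
     (\<forall>x\<in>topspace M. \<forall>p\<in>cotangent_space A x. K x p \<ge> 0) \<and>
     (\<forall>x\<in>topspace M. \<forall>c\<in>charts_at A x. \<forall>y\<in>tangent_space A x. \<forall>p\<in>cotangent_space A x.
        y \<noteq> (\<lambda>_. 0) \<and> p c = g_lower A F c x (y c) *v y c \<longrightarrow> K x p = F x y) \<and>
     (\<forall>x\<in>topspace M. K x (\<lambda>_. 0) = 0)"


section \<open>Leaves of the vertical foliation\<close>

text \<open>Points of the big-tangent manifold are triples \<open>(x, y, p)\<close> with \<open>y\<close> a vector and \<open>p\<close> a covector
  at \<open>x\<close>.\<close>

type_synonym ('m, 'e) big_tangent = "'m \<times> ('m, 'e) components \<times> ('m, 'e) components"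

text \<open>The coordinates \<open>(y\<^sup>i, p\<^sub>i)\<close> induced by a chart \<open>c\<close> of the base. They are global linear
  coordinates on the fibre over a point of \<open>cdom c\<close>, and identify the vertical vectors
  \<open>X\<^sub>1\<^sup>i \<partial>/\<partial>y\<^sup>i + X\<^sup>2\<^sub>i \<partial>/\<partial>p\<^sub>i\<close> with the pairs \<open>(X\<^sub>1, X\<^sup>2)\<close>.\<close>

fun fibre_coords :: "('m, 'e) chart \<Rightarrow> ('m, 'e) big_tangent \<Rightarrow> 'e \<times> 'e" where
  "fibre_coords c (x, y, p) = (y c, p c)"

text \<open>As \<open>V\<close> is the kernel of the differential of the projection to \<open>M\<close>, its leaves are the connected
  components of the fibres (where \<open>y \<noteq> 0\<close> and \<open>p \<noteq> 0\<close>). Fibres are connected except for \<open>n = 1\<close>. The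
  choice of \<open>c\<close> is immaterial, since a change of chart acts on a fibre by a linear isomorphism.\<close>

definition vertical_leaf :: "'m topology \<Rightarrow> ('m, 'e::euclidean_space) chart set \<Rightarrow>
    ('m, 'e) big_tangent set \<Rightarrow> bool" where
  "vertical_leaf M A L \<longleftrightarrow> (\<exists>x\<in>topspace M. \<exists>c\<in>charts_at A x.
     \<exists>C\<in>components ((- {0}) \<times> (- {0})).
       L = {q \<in> {x} \<times> tangent_space A x \<times> cotangent_space A x. fibre_coords c q \<in> C})"

text \<open>The metric \<open>G\<close> on the leaf in the fibre over \<open>x\<close>, in the coordinates \<open>(y\<^sup>i, p\<^sub>i)\<close> induced
  by \<open>c\<close>.\<close>

fun leaf_metric :: "('m, real^'n) chart set \<Rightarrow>
    ('m \<Rightarrow> ('m, real^'n) components \<Rightarrow> real) \<Rightarrow> ('m \<Rightarrow> ('m, real^'n) components \<Rightarrow> real) \<Rightarrow>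
    ('m, real^'n) chart \<Rightarrow> 'm \<Rightarrow>
    (real^'n) \<times> (real^'n) \<Rightarrow> (real^'n) \<times> (real^'n) \<Rightarrow> (real^'n) \<times> (real^'n) \<Rightarrow> real" where
  "leaf_metric A F K c x (v, w) (X1, X2) (Y1, Y2) =
     X1 \<bullet> (g_lower A F c x v *v Y1) + X2 \<bullet> (g_star A K c x w *v Y2)"

text \<open>\<open>y\<^sup>i \<partial>/\<partial>y\<^sup>i + p\<^sub>i \<partial>/\<partial>p\<^sub>i\<close>, in components.\<close>

fun vertical_liouville :: "('m, 'e) chart \<Rightarrow> ('m, 'e) big_tangent \<Rightarrow> 'e \<times> 'e" where
  "vertical_liouville c (x, y, p) = (y c, p c)"


section \<open>Sectional curvature in coordinates\<close>

text \<open>Below, \<open>g z\<close> is the metric at \<open>z\<close> in local coordinates with values in a Euclidean space \<open>'e\<close>,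
  and vectors are identified with constant vector fields.

  \<open>christoffel g z u v\<close> is the Levi-Civita covariant derivative at \<open>z\<close> of \<open>v\<close> along \<open>u\<close>, i.e.
  \<open>\<Gamma>\<^sup>k\<^sub>i\<^sub>j u\<^sup>i v\<^sup>j\<close>, characterised by the Koszul formula.\<close>

definition christoffel :: "('e::euclidean_space \<Rightarrow> 'e \<Rightarrow> 'e \<Rightarrow> real) \<Rightarrow> 'e \<Rightarrow> 'e \<Rightarrow> 'e \<Rightarrow> 'e" where
  "christoffel g z u v = (THE w. \<forall>t. g z w t = 1/2 *
     (frechet_derivative (\<lambda>a. g a v t) (at z) u
      + frechet_derivative (\<lambda>a. g a u t) (at z) v
      - frechet_derivative (\<lambda>a. g a u v) (at z) t))"

text \<open>\<open>R(u,v)w = \<nabla>\<^sub>u\<nabla>\<^sub>v w - \<nabla>\<^sub>v\<nabla>\<^sub>u w\<close> for constant fields; \<open>[u,v] = 0\<close>.\<close>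

definition riemann_curvature ::
    "('e::euclidean_space \<Rightarrow> 'e \<Rightarrow> 'e \<Rightarrow> real) \<Rightarrow> 'e \<Rightarrow> 'e \<Rightarrow> 'e \<Rightarrow> 'e \<Rightarrow> 'e" where
  "riemann_curvature g z u v w =
     frechet_derivative (\<lambda>a. christoffel g a v w) (at z) u
     + christoffel g z u (christoffel g z v w)
     - frechet_derivative (\<lambda>a. christoffel g a u w) (at z) v
     - christoffel g z v (christoffel g z u w)"

definition plane_section :: "'e::euclidean_space set \<Rightarrow> bool" where
  "plane_section P \<longleftrightarrow> subspace P \<and> dim P = 2"

definition nondegenerate_plane ::
    "('e::euclidean_space \<Rightarrow> 'e \<Rightarrow> 'e \<Rightarrow> real) \<Rightarrow> 'e \<Rightarrow> 'e set \<Rightarrow> bool" where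
  "nondegenerate_plane g z P \<longleftrightarrow> (\<forall>u\<in>P. (\<forall>v\<in>P. g z u v = 0) \<longrightarrow> u = 0)"

text \<open>The quotient has the same value for all bases \<open>u, v\<close> of a nondegenerate plane \<open>P\<close>.\<close>

definition sectional_curvature ::
    "('e::euclidean_space \<Rightarrow> 'e \<Rightarrow> 'e \<Rightarrow> real) \<Rightarrow> 'e \<Rightarrow> 'e set \<Rightarrow> real" where
  "sectional_curvature g z P = (THE k. \<forall>u v. u \<noteq> v \<and> independent {u, v} \<and> span {u, v} = P \<longrightarrow>
     k = g z (riemann_curvature g z u v v) u / (g z u u * g z v v - (g z u v)\<^sup>2))"

end

theory Submission
  imports Defs
begin

text \<open>Fix a chart around \<open>x\<close>. In the induced coordinates \<open>(y, p)\<close> the leaf is an open part of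
  \<open>\<real>\<^sup>n \<times> \<real>\<^sup>n\<close>, its metric is the product of \<open>g(y)\<close> and \<open>g\<^sup>*(p)\<close>, and the Liouville field at a point \<open>z = (y, p)\<close>
  is the position vector \<open>z\<close>. Both factors are Hessians of functions that are positively homogeneous of degree
  two. Hence the metric is homogeneous of degree zero and its first derivatives are totally symmetric, so the
  Christoffel symbols are \<open>\<Gamma>\<^sup>k\<^sub>i\<^sub>j = 1/2 g\<^sup>k\<^sup>l \<partial>\<^sub>i g\<^sub>j\<^sub>l\<close>. By Euler's relation they vanish when contracted with the
  position vector, and they have degree \<open>-1\<close>. These two facts alone give \<open>R(z, v)w = 0\<close>
  (\<open>curvature_radial\<close>). By bilinearity and antisymmetry \<open>R(u, v)\<close> then vanishes for every basis \<open>u, v\<close> of a plane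
  through \<open>z\<close>, and with it the sectional curvature.

  The work lies in showing that both factors are metrics of this kind, with enough differentiability for
  the curvature to be computed. For \<open>g\<close> this follows from the smoothness and homogeneity of \<open>F\<close>
  (\<open>minkowski_norm.hessian\<close>), with the symmetry of mixed derivatives as the main tool. For \<open>g\<^sup>*\<close> only the relation
  of \<open>K\<close> to \<open>F\<close> through the Legendre map \<open>v \<mapsto> g(v)v\<close> is known, so one has to prove that this map is a bijection
  of the nonzero vectors (\<open>legendre_injective\<close>, \<open>legendre_surjective\<close>) with differentiable inverse \<open>q\<close>. Then
  \<open>q\<close> is the gradient of \<open>K\<^sup>2/2\<close>, which identifies \<open>g\<^sup>*(w)\<close> with the inverse matrix of \<open>g(q w)\<close>
  (\<open>dual_hessian\<close>), and the required properties of the inverse metric are inherited from \<open>g\<close>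
  (\<open>dual_is_hessian\<close>). Finally, the charts around \<open>x\<close> induce linear coordinates on the fibres, so that all of this
  applies to \<open>F\<close> and \<open>K\<close>.\<close>

section \<open>Directional derivatives and homogeneity\<close>

text \<open>The direction precedes the point, so that \<open>dderiv f v\<close> is again a function of the point and can be
  differentiated once more.\<close>

abbreviation dderiv :: "('a::real_normed_vector \<Rightarrow> 'b::real_normed_vector) \<Rightarrow> 'a \<Rightarrow> 'a \<Rightarrow> 'b" where
  "dderiv f v \<equiv> \<lambda>z. frechet_derivative f (at z) v"

lemma dderiv_eqI: "(f has_derivative f') (at z) \<Longrightarrow> dderiv f v z = f' v"
  using frechet_derivative_at by fastforce

lemma has_derivative_dderiv:
  "f differentiable (at z) \<Longrightarrow> (f has_derivative (\<lambda>v. dderiv f v z)) (at z)"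
  by (simp add: frechet_derivative_works)

lemma linear_dderiv: "f differentiable (at z) \<Longrightarrow> linear (\<lambda>v. dderiv f v z)"
  using has_derivative_dderiv has_derivative_linear by blast

lemma dderiv_cong_open:
  assumes "f differentiable (at z)" "open S" "z \<in> S" "\<And>a. a \<in> S \<Longrightarrow> f a = h a"
  shows "dderiv f v z = dderiv h v z"
  using frechet_derivative_transform_within_open[OF assms] by simp

lemma differentiable_cong_open:
  assumes "f differentiable (at z)" "open S" "z \<in> S" "\<And>a. a \<in> S \<Longrightarrow> f a = h a"
  shows "h differentiable (at z)"
  using assms unfolding differentiable_def by (meson has_derivative_transform_within_open)

lemma line_has_real_derivative:
  fixes f :: "'a::real_normed_vector \<Rightarrow> real"
  assumes "f differentiable (at (a + s *\<^sub>R u))"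
  shows "((\<lambda>s. f (a + s *\<^sub>R u)) has_real_derivative dderiv f u (a + s *\<^sub>R u)) (at s)"
proof -
  have 1: "((\<lambda>s. a + s *\<^sub>R u) has_derivative (\<lambda>t. t *\<^sub>R u)) (at s)"
    by (auto intro!: derivative_eq_intros)
  have "((\<lambda>s. f (a + s *\<^sub>R u)) has_derivative (\<lambda>t. dderiv f (t *\<^sub>R u) (a + s *\<^sub>R u))) (at s)"
    using has_derivative_compose[OF 1 has_derivative_dderiv[OF assms]] .
  moreover have "(\<lambda>t. dderiv f (t *\<^sub>R u) (a + s *\<^sub>R u)) = (*) (dderiv f u (a + s *\<^sub>R u))"
    using linear_dderiv[OF assms] by (auto simp: linear_cmul)
  ultimately show ?thesis by (simp add: has_field_derivative_def)
qed

text \<open>The mean value theorem, applied once in each of the two directions. The left-hand side is symmetric in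
  \<open>u\<close> and \<open>v\<close>, which is what makes mixed second derivatives commute.\<close>

lemma second_difference_mean_value:
  fixes f :: "'a::real_normed_vector \<Rightarrow> real"
  assumes f: "\<And>z. z \<in> ball a r \<Longrightarrow> f differentiable (at z)"
    and fu: "\<And>z. z \<in> ball a r \<Longrightarrow> dderiv f u differentiable (at z)"
    and t: "t > 0" "t * (norm u + norm v) < r"
  obtains b where "b \<in> ball a r"
    "f (a + t *\<^sub>R u + t *\<^sub>R v) - f (a + t *\<^sub>R u) - f (a + t *\<^sub>R v) + f a
     = t\<^sup>2 * dderiv (dderiv f u) v b"
proof -
  have near: "a + s *\<^sub>R u + s' *\<^sub>R v \<in> ball a r" if "0 \<le> s" "s \<le> t" "0 \<le> s'" "s' \<le> t" for s s'
  proof -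
    have "norm (s *\<^sub>R u + s' *\<^sub>R v) \<le> s * norm u + s' * norm v"
      using that by (metis abs_of_nonneg norm_scaleR norm_triangle_ineq)
    also have "\<dots> \<le> t * norm u + t * norm v"
      using that by (intro add_mono mult_right_mono) auto
    also have "\<dots> < r" using t by (simp add: algebra_simps)
    finally have "norm (s *\<^sub>R u + s' *\<^sub>R v) < r" .
    moreover have "dist a (a + s *\<^sub>R u + s' *\<^sub>R v) = norm (s *\<^sub>R u + s' *\<^sub>R v)"
      by (metis add.assoc add_diff_cancel_left' dist_commute dist_norm)
    ultimately show ?thesis by simp
  qed
  define k where "k = (\<lambda>s. f ((a + t *\<^sub>R v) + s *\<^sub>R u) - f (a + s *\<^sub>R u))"
  have Dk: "(k has_real_derivative (dderiv f u ((a + t *\<^sub>R v) + s *\<^sub>R u) - dderiv f u (a + s *\<^sub>R u))) (at s)"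
    if "0 \<le> s" "s \<le> t" for s
    unfolding k_def
    using near[of s t] near[of s 0] that t
    by (intro DERIV_diff line_has_real_derivative f) (auto simp: algebra_simps)
  obtain s where s: "0 < s" "s < t"
    and ks: "k t - k 0 = (t - 0) * (dderiv f u ((a + t *\<^sub>R v) + s *\<^sub>R u) - dderiv f u (a + s *\<^sub>R u))"
    using MVT2[OF t(1) Dk] by blast
  have Dd: "((\<lambda>s'. dderiv f u ((a + s *\<^sub>R u) + s' *\<^sub>R v)) has_real_derivative
        dderiv (dderiv f u) v ((a + s *\<^sub>R u) + s' *\<^sub>R v)) (at s')"
    if "0 \<le> s'" "s' \<le> t" for s'
    using near[of s s'] that s by (intro line_has_real_derivative fu) auto
  obtain s' where s': "0 < s'" "s' < t"
    and ds: "dderiv f u ((a + s *\<^sub>R u) + t *\<^sub>R v) - dderiv f u ((a + s *\<^sub>R u) + 0 *\<^sub>R v)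
        = (t - 0) * dderiv (dderiv f u) v ((a + s *\<^sub>R u) + s' *\<^sub>R v)"
    using MVT2[OF t(1) Dd] by blast
  show ?thesis
  proof (rule that)
    show "a + s *\<^sub>R u + s' *\<^sub>R v \<in> ball a r" using near s s' by simp
    have "k t - k 0 = t * (t * dderiv (dderiv f u) v ((a + s *\<^sub>R u) + s' *\<^sub>R v))"
      using ks ds by (simp add: algebra_simps)
    then show "f (a + t *\<^sub>R u + t *\<^sub>R v) - f (a + t *\<^sub>R u) - f (a + t *\<^sub>R v) + f a
      = t\<^sup>2 * dderiv (dderiv f u) v (a + s *\<^sub>R u + s' *\<^sub>R v)"
      unfolding k_def by (simp add: power2_eq_square algebra_simps)
  qed
qed

text \<open>The same second difference is \<open>t\<^sup>2\<close> times a value of either mixed derivative near \<open>a\<close>;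
  continuity at \<open>a\<close> then forbids the two from differing there.\<close>

lemma dderiv_commute:
  fixes f :: "'a::euclidean_space \<Rightarrow> real"
  assumes S: "open S" "a \<in> S" and f: "Ck_on (Suc (Suc 0)) S f"
  shows "dderiv (dderiv f u) v a = dderiv (dderiv f v) u a"
proof (rule ccontr)
  let ?X = "dderiv (dderiv f u) v" and ?Y = "dderiv (dderiv f v) u"
  assume ne: "?X a \<noteq> ?Y a"
  define e where "e = \<bar>?X a - ?Y a\<bar> / 2"
  have e: "e > 0" using ne by (simp add: e_def)
  have cont: "continuous (at a) ?X" "continuous (at a) ?Y"
    using f S by (auto simp: continuous_on_eq_continuous_at)
  obtain d1 where d1: "d1 > 0" "\<And>b. dist b a < d1 \<Longrightarrow> dist (?X b) (?X a) < e"
    using cont(1) e unfolding continuous_at_eps_delta by blast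
  obtain d2 where d2: "d2 > 0" "\<And>b. dist b a < d2 \<Longrightarrow> dist (?Y b) (?Y a) < e"
    using cont(2) e unfolding continuous_at_eps_delta by blast
  obtain d3 where d3: "d3 > 0" "ball a d3 \<subseteq> S" using S openE by blast
  define r where "r = min d1 (min d2 d3)"
  have r: "r > 0" "ball a r \<subseteq> S" using d1 d2 d3 by (auto simp: r_def)
  \<comment> \<open>the summand \<open>1\<close> keeps the denominator positive when \<open>u = v = 0\<close>\<close>
  define t where "t = r / (2 * (norm u + norm v + 1))"
  have N: "norm u + norm v + 1 > 0" by (simp add: add_nonneg_pos)
  have t: "t > 0" using r N by (simp add: t_def)
  have "t * (norm u + norm v) \<le> t * (norm u + norm v + 1)"
    using t by (intro mult_left_mono) auto
  also have "\<dots> = r / 2" using N by (simp add: t_def field_simps)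
  also have "\<dots> < r" using r by simp
  finally have tr: "t * (norm u + norm v) < r" .
  then have tr': "t * (norm v + norm u) < r" by (simp add: add.commute)
  have diff: "\<And>z. z \<in> ball a r \<Longrightarrow> f differentiable (at z)"
      "\<And>z w. z \<in> ball a r \<Longrightarrow> dderiv f w differentiable (at z)"
    using f r by auto
  obtain b where b: "b \<in> ball a r"
    "f (a + t *\<^sub>R u + t *\<^sub>R v) - f (a + t *\<^sub>R u) - f (a + t *\<^sub>R v) + f a = t\<^sup>2 * ?X b"
    using second_difference_mean_value[OF diff t tr] by blast
  obtain b' where b': "b' \<in> ball a r"
    "f (a + t *\<^sub>R v + t *\<^sub>R u) - f (a + t *\<^sub>R v) - f (a + t *\<^sub>R u) + f a = t\<^sup>2 * ?Y b'"
    using second_difference_mean_value[OF diff t tr'] by blast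
  have "f (a + t *\<^sub>R v + t *\<^sub>R u) = f (a + t *\<^sub>R u + t *\<^sub>R v)" by (simp add: ac_simps)
  then have "t\<^sup>2 * ?X b = t\<^sup>2 * ?Y b'" using b(2) b'(2) by linarith
  then have "?X b = ?Y b'" using t by simp
  moreover have "dist (?X b) (?X a) < e" "dist (?Y b') (?Y a) < e"
    using b(1) b'(1) d1(2)[of b] d2(2)[of b'] by (simp_all add: r_def dist_commute)
  moreover have "\<bar>?X a - ?Y a\<bar> = 2 * e" by (simp add: e_def)
  ultimately show False unfolding dist_real_def by (smt (verit))
qed

text \<open>Differentiating a homogeneous function lowers its degree by one.\<close>

lemma homogeneous_dderiv:
  fixes f :: "'a::real_normed_vector \<Rightarrow> 'b::real_normed_vector"
  assumes hom: "\<And>w. w \<noteq> 0 \<Longrightarrow> f (t *\<^sub>R w) = s *\<^sub>R f w"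
    and f: "\<And>w. w \<noteq> 0 \<Longrightarrow> f differentiable (at w)"
    and v: "v \<noteq> 0" "t \<noteq> 0"
  shows "t *\<^sub>R dderiv f u (t *\<^sub>R v) = s *\<^sub>R dderiv f u v"
proof -
  have 1: "((\<lambda>w. t *\<^sub>R w) has_derivative (\<lambda>u. t *\<^sub>R u)) (at v)"
    by (auto intro!: derivative_eq_intros)
  have 2: "f differentiable (at (t *\<^sub>R v))" using v by (intro f) auto
  have d: "((\<lambda>w. f (t *\<^sub>R w)) has_derivative (\<lambda>u. dderiv f (t *\<^sub>R u) (t *\<^sub>R v))) (at v)"
    using has_derivative_compose[OF 1 has_derivative_dderiv[OF 2]] .
  have d': "((\<lambda>w. f (t *\<^sub>R w)) has_derivative (\<lambda>u. s *\<^sub>R dderiv f u v)) (at v)"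
    by (rule has_derivative_transform_within_open[where s = "- {0}" and f = "\<lambda>w. s *\<^sub>R f w"])
      (use v f hom in \<open>auto intro!: has_derivative_scaleR_right has_derivative_dderiv\<close>)
  have "dderiv f (t *\<^sub>R u) (t *\<^sub>R v) = s *\<^sub>R dderiv f u v"
    using has_derivative_unique[OF d d'] by meson
  then show ?thesis using linear_dderiv[OF 2] by (simp add: linear_cmul)
qed

text \<open>Euler's relation. The degree is an integer because Christoffel symbols have degree \<open>-1\<close>.\<close>

lemma euler_dderiv:
  fixes f :: "'a::real_normed_vector \<Rightarrow> 'b::real_normed_vector"
  assumes hom: "\<And>t. t > 0 \<Longrightarrow> f (t *\<^sub>R v) = t powi m *\<^sub>R f v"
    and f: "f differentiable (at v)"
  shows "dderiv f v v = of_int m *\<^sub>R f v"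
proof -
  have 1: "((\<lambda>t::real. t *\<^sub>R v) has_derivative (\<lambda>t. t *\<^sub>R v)) (at 1)"
    by (auto intro!: derivative_eq_intros)
  have f': "f differentiable (at (1 *\<^sub>R v))" using f by simp
  have "((\<lambda>t. f (t *\<^sub>R v)) has_derivative (\<lambda>t. dderiv f (t *\<^sub>R v) v)) (at 1)"
    using has_derivative_compose[OF 1 has_derivative_dderiv[OF f']] by simp
  moreover have "((\<lambda>t. f (t *\<^sub>R v)) has_derivative (\<lambda>t. (t * of_int m) *\<^sub>R f v)) (at 1)"
  proof (rule has_derivative_transform_within_open[where s = "{0<..}"])
    show "((\<lambda>t. t powi m *\<^sub>R f v) has_derivative (\<lambda>t. (t * of_int m) *\<^sub>R f v)) (at (1::real))"
      by (auto intro!: derivative_eq_intros)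
  qed (use hom in auto)
  ultimately have "(\<lambda>t::real. dderiv f (t *\<^sub>R v) v) = (\<lambda>t. (t * of_int m) *\<^sub>R f v)"
    by (rule has_derivative_unique)
  from fun_cong[OF this, of 1] show ?thesis by simp
qed

lemma Ck_on_cong:
  assumes "open S" "Ck_on k S f" "\<And>a. a \<in> S \<Longrightarrow> f a = h a"
  shows "Ck_on k S h"
  using assms(2,3)
proof (induction k arbitrary: f h)
  case 0
  then show ?case using continuous_on_cong[of S S f h] by simp
next
  case (Suc k)
  have "h differentiable (at a)" if "a \<in> S" for a
    by (rule differentiable_cong_open[OF _ assms(1) that, of f]) (use Suc.prems that in auto)
  moreover have "Ck_on k S (dderiv h v)" for v
  proof (rule Suc.IH)
    show "Ck_on k S (dderiv f v)" using Suc.prems by simp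
    show "dderiv f v a = dderiv h v a" if "a \<in> S" for a
      using Suc.prems that by (intro dderiv_cong_open[OF _ assms(1) that]) auto
  qed
  ultimately show ?case by simp
qed

lemma Ck_on_Suc_imp: "Ck_on (Suc k) S f \<Longrightarrow> Ck_on k S f"
proof (induction k arbitrary: f)
  case 0
  then have "f differentiable_on S"
    by (simp add: differentiable_on_def differentiable_at_withinI)
  then show ?case by (simp add: differentiable_imp_continuous_on)
next
  case (Suc k)
  then show ?case unfolding Ck_on.simps(2)[of "Suc k" S f] Ck_on.simps(2)[of k S f] by blast
qed

lemma Ck_on_add:
  assumes "open S" "Ck_on k S f" "Ck_on k S h"
  shows "Ck_on k S (\<lambda>a. f a + h a)"
  using assms(2,3)
proof (induction k arbitrary: f h)
  case (Suc k)
  have "Ck_on k S (dderiv (\<lambda>a. f a + h a) v)" for v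
  proof (rule Ck_on_cong[OF assms(1)])
    show "Ck_on k S (\<lambda>a. dderiv f v a + dderiv h v a)" using Suc by simp
    show "dderiv f v a + dderiv h v a = dderiv (\<lambda>a. f a + h a) v a" if "a \<in> S" for a
      using Suc.prems that
      by (intro dderiv_eqI[symmetric] has_derivative_add has_derivative_dderiv) auto
  qed
  then show ?case using Suc.prems by simp
qed (simp add: continuous_on_add)

lemma Ck_on_mult:
  fixes f h :: "'a::euclidean_space \<Rightarrow> real"
  assumes "open S" "Ck_on k S f" "Ck_on k S h"
  shows "Ck_on k S (\<lambda>a. f a * h a)"
  using assms(2,3)
proof (induction k arbitrary: f h)
  case (Suc k)
  have "Ck_on k S (dderiv (\<lambda>a. f a * h a) v)" for v
  proof (rule Ck_on_cong[OF assms(1)])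
    show "Ck_on k S (\<lambda>a. f a * dderiv h v a + dderiv f v a * h a)"
      using Suc.prems Suc.prems[THEN Ck_on_Suc_imp] by (intro Ck_on_add[OF assms(1)] Suc.IH) simp_all
    show "f a * dderiv h v a + dderiv f v a * h a = dderiv (\<lambda>a. f a * h a) v a" if "a \<in> S" for a
      using Suc.prems that
      by (intro dderiv_eqI[symmetric] has_derivative_mult has_derivative_dderiv) auto
  qed
  then show ?case using Suc.prems by simp
qed (simp add: continuous_on_mult)

text \<open>Fixing the base point turns joint smoothness on the slit tangent bundle into smoothness on one fibre.\<close>

lemma Ck_on_slice:
  assumes T: "open T" and "a \<in> S" "Ck_on k (S \<times> T) f"
  shows "Ck_on k T (\<lambda>v. f (a, v))"
  using assms(3)
proof (induction k arbitrary: f)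
  case 0
  then have "continuous_on (S \<times> T) f" by simp
  then have "continuous_on T (\<lambda>v. f (a, v))"
    by (rule continuous_on_compose2[of "S \<times> T" f T "\<lambda>v. (a, v)"])
      (use assms(2) in \<open>auto intro: continuous_on_Pair continuous_on_const continuous_on_id\<close>)
  then show ?case by simp
next
  case (Suc k)
  have d: "((\<lambda>v. f (a, v)) has_derivative (\<lambda>u. dderiv f (0, u) (a, v))) (at v)" if "v \<in> T" for v
  proof -
    have "((\<lambda>v. (a, v)) has_derivative (\<lambda>u. (0, u))) (at v)"
      by (auto intro!: derivative_eq_intros)
    moreover have "f differentiable (at (a, v))" using Suc.prems assms(2) that by simp
    ultimately show ?thesis by (intro has_derivative_compose[OF _ has_derivative_dderiv])
  qed
  have "Ck_on k T (dderiv (\<lambda>v. f (a, v)) u)" for u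
  proof (rule Ck_on_cong[OF T])
    show "Ck_on k T (\<lambda>v. dderiv f (0, u) (a, v))"
      using Suc.prems by (intro Suc.IH) simp
    show "dderiv f (0, u) (a, v) = dderiv (\<lambda>v. f (a, v)) u v" if "v \<in> T" for v
      using dderiv_eqI[OF d[OF that]] by simp
  qed
  then show ?case using d by (auto simp: differentiable_def)
qed

lemma smooth_on_dderiv: "smooth_on S f \<Longrightarrow> smooth_on S (dderiv f v)"
  unfolding smooth_on_def using Ck_on.simps(2) by blast

lemma smooth_on_differentiable: "smooth_on S f \<Longrightarrow> a \<in> S \<Longrightarrow> f differentiable (at a)"
  unfolding smooth_on_def using Ck_on.simps(2) by blast

section \<open>Differentiating matrix-valued functions\<close>

lemma bounded_bilinear_matrix_vector_mult:
  "bounded_bilinear ((*v) :: real^'n^'m \<Rightarrow> real^'n \<Rightarrow> real^'m)"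
  unfolding bilinear_conv_bounded_bilinear[symmetric] bilinear_def
  by (auto intro!: linearI simp: matrix_vector_mult_add_rdistrib matrix_vector_right_distrib
      scaleR_matrix_vector_assoc matrix_vector_mult_scaleR)

lemma matrix_mul_add_rdistrib: "(A + B) ** C = A ** C + B ** (C :: real^'k^'n)"
  by (simp add: matrix_matrix_mult_def vec_eq_iff sum.distrib distrib_right)

lemma bounded_bilinear_matrix_matrix_mult:
  "bounded_bilinear ((**) :: real^'n^'m \<Rightarrow> real^'k^'n \<Rightarrow> real^'k^'m)"
  unfolding bilinear_conv_bounded_bilinear[symmetric] bilinear_def
  by (auto intro!: linearI simp: matrix_mul_add_rdistrib matrix_add_ldistrib matrix_scalar_ac
     scalar_matrix_assoc)

lemma differentiable_matrixI:
  fixes S :: "'a::real_normed_vector \<Rightarrow> real^'n^'m"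
  assumes "\<And>i j. (\<lambda>a. S a $ i $ j) differentiable (at x)"
  shows "S differentiable (at x)"
  by (subst differentiable_componentwise_within) (use assms in \<open>auto simp: Basis_vec_def inner_axis\<close>)

lemma has_derivative_matrix_nth:
  fixes S :: "'a::real_normed_vector \<Rightarrow> real^'n^'m"
  assumes "S differentiable (at a)"
  shows "((\<lambda>a. S a $ i $ j) has_derivative (\<lambda>u. dderiv S u a $ i $ j)) (at a)"
  by (intro bounded_linear.has_derivative[OF bounded_linear_vec_nth] has_derivative_dderiv assms)

lemma differentiable_det:
  fixes S :: "'a::real_normed_vector \<Rightarrow> real^'n^'n"
  assumes "\<And>i j. (\<lambda>a. S a $ i $ j) differentiable (at x)"
  shows "(\<lambda>a. det (S a)) differentiable (at x)"
proof -
  have "(\<lambda>a. \<Prod>i\<in>UNIV. S a $ i $ p i) differentiable (at x)" for p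
    unfolding differentiable_def
    by (rule exI, rule has_derivative_prod) (rule has_derivative_dderiv[OF assms])
  then show ?thesis unfolding det_def
    by (intro differentiable_sum differentiable_mult) (auto simp: finite_permutations)
qed

lemma matrix_inv_inverse:
  fixes A :: "real^'n^'n"
  assumes "invertible A"
  shows "A ** matrix_inv A = mat 1" "matrix_inv A ** A = mat 1"
proof -
  have "A ** matrix_inv A = mat 1 \<and> matrix_inv A ** A = mat 1"
    using assms unfolding invertible_def matrix_inv_def by (rule someI_ex)
  then show "A ** matrix_inv A = mat 1" "matrix_inv A ** A = mat 1" by auto
qed

lemma matrix_inv_eqI:
  fixes A :: "real^'n^'n"
  assumes "A ** B = mat 1"
  shows "matrix_inv A = B"
proof -
  have "invertible A" using assms matrix_left_right_inverse unfolding invertible_def by blast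
  then show ?thesis
    by (metis assms matrix_inv_inverse(2) matrix_mul_assoc matrix_mul_lid matrix_mul_rid)
qed

text \<open>Cramer's rule. Entries of the inverse are rational functions of the entries of the matrix, whence
  inversion is differentiable.\<close>

lemma matrix_inv_nth:
  fixes A :: "real^'n^'n"
  assumes "det A \<noteq> 0"
  shows "matrix_inv A $ k $ l = det (\<chi> i j. if j = k then axis l 1 $ i else A $ i $ j) / det A"
proof -
  have "A *v (matrix_inv A *v axis l 1) = axis l 1"
    using assms matrix_inv_inverse[of A] by (simp add: invertible_det_nz matrix_vector_mul_assoc)
  then have "matrix_inv A *v axis l 1
      = (\<chi> k. det (\<chi> i j. if j = k then axis l 1 $ i else A $ i $ j) / det A)"
    using cramer[OF assms] by blast
  then have "(matrix_inv A *v axis l 1) $ k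
      = det (\<chi> i j. if j = k then axis l 1 $ i else A $ i $ j) / det A" by simp
  then show ?thesis by (simp add: matrix_vector_mul_component inner_axis)
qed

lemma differentiable_matrix_inv:
  fixes S :: "'a::real_normed_vector \<Rightarrow> real^'n^'n"
  assumes S: "S differentiable (at a)" and inv: "invertible (S a)"
  shows "(\<lambda>b. matrix_inv (S b)) differentiable (at a)"
proof (rule differentiable_matrixI)
  fix k l
  have nth: "(\<lambda>b. S b $ i $ j) differentiable (at a)" for i j
    using has_derivative_matrix_nth[OF S] by (auto simp: differentiable_def)
  have d0: "det (S a) \<noteq> 0" using inv by (simp add: invertible_det_nz)
  have "isCont (\<lambda>b. det (S b)) a"
    using differentiable_det[of S a] nth differentiable_imp_continuous_within by blast
  then have "\<forall>\<^sub>F b in at a. det (S b) \<noteq> 0"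
    using d0 unfolding isCont_def by (rule tendsto_imp_eventually_ne)
  then have ev: "\<forall>\<^sub>F b in at a. det (\<chi> i j. if j = k then axis l 1 $ i else S b $ i $ j) / det (S b)
      = matrix_inv (S b) $ k $ l"
    by eventually_elim (simp add: matrix_inv_nth)
  have "(\<lambda>b. det (\<chi> i j. if j = k then axis l 1 $ i else S b $ i $ j) / det (S b)) differentiable (at a)"
    (is "?r differentiable _")
  proof (intro differentiable_divide differentiable_det)
    show "(\<lambda>b. (\<chi> i j. if j = k then axis l 1 $ i else S b $ i $ j) $ i $ j) differentiable (at a)" for i j
      using nth by (cases "j = k") auto
  qed (use d0 nth in auto)
  then obtain D where "(?r has_derivative D) (at a)" unfolding differentiable_def by blast
  from has_derivative_transform_eventually[OF this ev]
  show "(\<lambda>b. matrix_inv (S b) $ k $ l) differentiable (at a)"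
    using d0 by (auto simp: matrix_inv_nth differentiable_def)
qed

text \<open>Differentiate \<open>S S\<^sup>-\<^sup>1 = 1\<close>.\<close>

lemma dderiv_matrix_inv:
  fixes S :: "'a::real_normed_vector \<Rightarrow> real^'n^'n"
  assumes S: "S differentiable (at a)" and O: "open U" "a \<in> U" "\<And>b. b \<in> U \<Longrightarrow> invertible (S b)"
  shows "dderiv (\<lambda>b. matrix_inv (S b)) u a = - (matrix_inv (S a) ** dderiv S u a ** matrix_inv (S a))"
proof -
  let ?T = "\<lambda>b. matrix_inv (S b)"
  have T: "?T differentiable (at a)" using differentiable_matrix_inv S O by blast
  have "((\<lambda>b. S b ** ?T b) has_derivative (\<lambda>u. S a ** dderiv ?T u a + dderiv S u a ** ?T a)) (at a)"
    by (intro bounded_bilinear.FDERIV[OF bounded_bilinear_matrix_matrix_mult] has_derivative_dderiv S T)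
  moreover have "((\<lambda>b. S b ** ?T b) has_derivative (\<lambda>u. 0)) (at a)"
    by (rule has_derivative_transform_within_open[OF _ O(1,2), of "\<lambda>b. mat 1"])
      (auto simp: O matrix_inv_inverse)
  ultimately have "(\<lambda>u. S a ** dderiv ?T u a + dderiv S u a ** ?T a) = (\<lambda>u. 0)"
    by (rule has_derivative_unique)
  from fun_cong[OF this, of u] have "S a ** dderiv ?T u a + dderiv S u a ** ?T a = 0" .
  then have "S a ** dderiv ?T u a = - (dderiv S u a ** ?T a)"
    unfolding eq_neg_iff_add_eq_0 .
  then have "?T a ** (S a ** dderiv ?T u a) = ?T a ** - (dderiv S u a ** ?T a)"
    by simp
  then show ?thesis
    using matrix_inv_inverse(2)[of "S a"] O
    by (simp add: matrix_mul_assoc bounded_bilinear.minus_right[OF bounded_bilinear_matrix_matrix_mult])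
qed

lemma differentiable_matrix_matrix_mult:
  fixes f :: "'a::real_normed_vector \<Rightarrow> real^'n^'m" and k :: "'a \<Rightarrow> real^'k^'n"
  assumes "f differentiable (at a)" "k differentiable (at a)"
  shows "(\<lambda>b. f b ** k b) differentiable (at a)"
  by (rule differentiableI, rule bounded_bilinear.FDERIV[OF bounded_bilinear_matrix_matrix_mult])
    (rule has_derivative_dderiv, fact)+

lemma transpose_matrix_inv:
  fixes A :: "real^'n^'n"
  assumes "transpose A = A" "invertible A"
  shows "transpose (matrix_inv A) = matrix_inv A"
proof -
  have "A ** transpose (matrix_inv A) = transpose (matrix_inv A ** A)"
    using assms(1) by (simp add: matrix_transpose_mul)
  also have "\<dots> = mat 1" using matrix_inv_inverse(2)[OF assms(2)] by simp
  finally show ?thesis using matrix_inv_eqI by metis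
qed

section \<open>Curvature of planes containing the radial direction\<close>

lemma linear_expansion:
  fixes f :: "'a::euclidean_space \<Rightarrow> 'b::real_vector"
  assumes "linear f"
  shows "f u = (\<Sum>b\<in>Basis. (u \<bullet> b) *\<^sub>R f b)"
proof -
  have "f u = f (\<Sum>b\<in>Basis. (u \<bullet> b) *\<^sub>R b)" by (simp add: euclidean_representation)
  also have "\<dots> = (\<Sum>b\<in>Basis. (u \<bullet> b) *\<^sub>R f b)"
    using assms by (simp add: linear_sum linear_cmul)
  finally show ?thesis .
qed

text \<open>The properties of the Christoffel symbols that force the curvature to vanish in the direction of the
  position vector \<open>z\<close>: they annihilate the position vector at every point of an open set, and they have
  degree \<open>-1\<close> along the ray through \<open>z\<close>.\<close>

locale radially_flat_connection =
  fixes g :: "'e::euclidean_space \<Rightarrow> 'e \<Rightarrow> 'e \<Rightarrow> real" and \<Gamma> :: "'e \<Rightarrow> 'e \<Rightarrow> 'e \<Rightarrow> 'e"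
    and U :: "'e set" and z :: 'e
  assumes U: "open U" "z \<in> U"
    and christoffel: "a \<in> U \<Longrightarrow> christoffel g a u v = \<Gamma> a u v"
    and linear1: "a \<in> U \<Longrightarrow> linear (\<lambda>u. \<Gamma> a u v)"
    and linear2: "a \<in> U \<Longrightarrow> linear (\<Gamma> a u)"
    and diff: "(\<lambda>a. \<Gamma> a u v) differentiable (at z)"
    and radial: "a \<in> U \<Longrightarrow> \<Gamma> a a v = 0"
    and homogeneous: "t > 0 \<Longrightarrow> \<Gamma> (t *\<^sub>R z) u v = inverse t *\<^sub>R \<Gamma> z u v"
begin

lemma curvature_eq:
  "riemann_curvature g z u v w = dderiv (\<lambda>a. \<Gamma> a v w) u z + \<Gamma> z u (\<Gamma> z v w)
     - dderiv (\<lambda>a. \<Gamma> a u w) v z - \<Gamma> z v (\<Gamma> z u w)"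
proof -
  have "dderiv (\<lambda>a. christoffel g a v w) u z = dderiv (\<lambda>a. \<Gamma> a v w) u z" for u v
    by (rule dderiv_cong_open[OF _ U, symmetric]) (use diff christoffel in auto)
  then show ?thesis unfolding riemann_curvature_def using christoffel U by simp
qed

lemma dderiv_radial: "dderiv (\<lambda>a. \<Gamma> a v w) z z = - \<Gamma> z v w"
proof -
  have "dderiv (\<lambda>a. \<Gamma> a v w) z z = of_int (-1) *\<^sub>R \<Gamma> z v w"
    by (rule euler_dderiv) (use homogeneous diff in \<open>auto simp: power_int_minus\<close>)
  then show ?thesis by simp
qed

text \<open>By the radial identity \<open>\<Gamma> a a w = 0\<close> one may replace \<open>\<Gamma> a z w\<close> by \<open>\<Gamma> a (z - a) w\<close>. The direction
  \<open>z - a\<close> vanishes at \<open>a = z\<close>, so only its variation contributes to the derivative at \<open>z\<close>.\<close>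

lemma dderiv_at_radial: "dderiv (\<lambda>a. \<Gamma> a z w) v z = - \<Gamma> z v w"
proof (rule dderiv_eqI)
  have "((\<lambda>a. \<Sum>b\<in>Basis. ((z - a) \<bullet> b) *\<^sub>R \<Gamma> a b w) has_derivative
      (\<lambda>v. \<Sum>b\<in>Basis. ((z - z) \<bullet> b) *\<^sub>R dderiv (\<lambda>a. \<Gamma> a b w) v z + ((0 - v) \<bullet> b) *\<^sub>R \<Gamma> z b w)) (at z)"
    by (intro has_derivative_sum has_derivative_scaleR has_derivative_inner_left has_derivative_diff
        has_derivative_const has_derivative_ident has_derivative_dderiv diff)
  moreover have "\<Gamma> z (0 - v) w = (\<Sum>b\<in>Basis. ((z - z) \<bullet> b) *\<^sub>R dderiv (\<lambda>a. \<Gamma> a b w) v z + ((0 - v) \<bullet> b) *\<^sub>R \<Gamma> z b w)" for v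
    using linear_expansion[OF linear1[OF U(2)], of "0 - v" w] by simp
  ultimately have 1: "((\<lambda>a. \<Sum>b\<in>Basis. ((z - a) \<bullet> b) *\<^sub>R \<Gamma> a b w) has_derivative (\<lambda>v. \<Gamma> z (0 - v) w)) (at z)"
    by simp
  have 2: "(\<Sum>b\<in>Basis. ((z - a) \<bullet> b) *\<^sub>R \<Gamma> a b w) = \<Gamma> a z w" if "a \<in> U" for a
  proof -
    have "\<Gamma> a z w = \<Gamma> a (z - a) w"
      using linear_diff[OF linear1[OF that], of z a w] radial[OF that] by simp
    also have "\<dots> = (\<Sum>b\<in>Basis. ((z - a) \<bullet> b) *\<^sub>R \<Gamma> a b w)"
      by (rule linear_expansion[OF linear1[OF that]])
    finally show ?thesis by simp
  qed
  from has_derivative_transform_within_open[OF 1 U 2]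
  show "((\<lambda>a. \<Gamma> a z w) has_derivative (\<lambda>v. - \<Gamma> z v w)) (at z)"
    using linear_neg[OF linear1[OF U(2)]] by simp
qed

text \<open>In \<open>R(z,v)w\<close> both products of Christoffel symbols contain \<open>\<Gamma> z z\<close> and vanish. The two derivative terms
  are both equal to \<open>- \<Gamma> z v w\<close>, one by homogeneity and one by the radial identity, and they cancel.\<close>

lemma curvature_radial: "riemann_curvature g z z v w = 0"
  using radial[OF U(2)] linear_0[OF linear2[OF U(2)]]
  by (simp add: curvature_eq dderiv_radial dderiv_at_radial)

lemma curvature_antisym: "riemann_curvature g z v u w = - riemann_curvature g z u v w"
  by (simp add: curvature_eq)

lemma linear_curvature: "linear (\<lambda>u. riemann_curvature g z u v w)"
proof -
  have "linear (\<lambda>u. dderiv (\<lambda>a. \<Gamma> a v w) u z)"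
    using linear_dderiv diff by blast
  moreover have "linear (\<lambda>u. \<Gamma> z u (\<Gamma> z v w))" by (rule linear1[OF U(2)])
  moreover have "linear (\<lambda>u. \<Gamma> z v (\<Gamma> z u w))"
    using linear_compose[OF linear1[OF U(2)] linear2[OF U(2)]] by (simp add: o_def)
  moreover have "linear (\<lambda>u. dderiv (\<lambda>a. \<Gamma> a u w) v z)"
  proof (rule linearI)
    fix u u' and r :: real
    have "dderiv (\<lambda>a. \<Gamma> a (u + u') w) v z = dderiv (\<lambda>a. \<Gamma> a u w + \<Gamma> a u' w) v z"
      by (rule dderiv_cong_open[OF diff U]) (rule linear_add[OF linear1])
    also have "\<dots> = dderiv (\<lambda>a. \<Gamma> a u w) v z + dderiv (\<lambda>a. \<Gamma> a u' w) v z"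
      by (rule dderiv_eqI) (intro has_derivative_add has_derivative_dderiv diff)
    finally show "dderiv (\<lambda>a. \<Gamma> a (u + u') w) v z
        = dderiv (\<lambda>a. \<Gamma> a u w) v z + dderiv (\<lambda>a. \<Gamma> a u' w) v z" .
    have "dderiv (\<lambda>a. \<Gamma> a (r *\<^sub>R u) w) v z = dderiv (\<lambda>a. r *\<^sub>R \<Gamma> a u w) v z"
      by (rule dderiv_cong_open[OF diff U]) (rule linear_cmul[OF linear1])
    also have "\<dots> = r *\<^sub>R dderiv (\<lambda>a. \<Gamma> a u w) v z"
      by (rule dderiv_eqI) (intro has_derivative_scaleR_right has_derivative_dderiv diff)
    finally show "dderiv (\<lambda>a. \<Gamma> a (r *\<^sub>R u) w) v z = r *\<^sub>R dderiv (\<lambda>a. \<Gamma> a u w) v z" .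
  qed
  ultimately show ?thesis
    unfolding curvature_eq by (intro linear_compose_add linear_compose_sub)
qed

text \<open>For \<open>z = \<alpha> u + \<beta> v\<close>, the expressions \<open>R(z,v)\<close> and \<open>R(z,u)\<close> are \<open>\<alpha> R(u,v)\<close> and \<open>- \<beta> R(u,v)\<close>. As \<open>\<alpha>\<close> and
  \<open>\<beta>\<close> are not both zero, \<open>R(u,v)\<close> vanishes for every basis \<open>u, v\<close> of the plane. A basis exists, so the
  value \<open>0\<close> of the curvature is the only one that satisfies its defining condition.\<close>

lemma sectional_curvature_zero:
  assumes P: "plane_section P" "z \<in> P" "z \<noteq> 0" and g0: "\<And>u. g z 0 u = 0"
  shows "sectional_curvature g z P = 0"
proof -
  let ?R = "riemann_curvature g z"
  have flat: "?R u v w = 0" if "z \<in> span {u, v}" for u v w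
  proof -
    have "\<exists>\<alpha>. z - \<alpha> *\<^sub>R u \<in> span {v}"
      using that span_breakdown_eq[of z u "{v}"] by blast
    then obtain \<alpha> \<beta> where "z - \<alpha> *\<^sub>R u = \<beta> *\<^sub>R v" unfolding span_singleton by blast
    then have z: "z = \<alpha> *\<^sub>R u + \<beta> *\<^sub>R v" by (simp add: algebra_simps)
    have self: "?R v v w = 0" for v by (simp add: curvature_eq)
    have split: "?R z v' w = \<alpha> *\<^sub>R ?R u v' w + \<beta> *\<^sub>R ?R v v' w" for v'
      using linear_add[OF linear_curvature, of "\<alpha> *\<^sub>R u" "\<beta> *\<^sub>R v" v' w]
        linear_cmul[OF linear_curvature, of \<alpha> u v' w] linear_cmul[OF linear_curvature, of \<beta> v v' w]
      by (simp flip: z)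
    have "?R z v w = \<alpha> *\<^sub>R ?R u v w" "?R z u w = - (\<beta> *\<^sub>R ?R u v w)"
      using self curvature_antisym[of v u w] by (simp_all add: split)
    then have "\<alpha> *\<^sub>R ?R u v w = 0" "\<beta> *\<^sub>R ?R u v w = 0"
      using curvature_radial by simp_all
    moreover have "\<alpha> \<noteq> 0 \<or> \<beta> \<noteq> 0" using z P(3) by auto
    ultimately show ?thesis by auto
  qed
  obtain B where B: "independent B" "span B = P" "card B = 2"
    using P(1) unfolding plane_section_def by (metis basis_exists span_subspace)
  then obtain u v where uv: "u \<noteq> v" "B = {u, v}" by (meson card_2_iff)
  show ?thesis
    unfolding sectional_curvature_def
  proof (rule the_equality)
    show "\<forall>u v. u \<noteq> v \<and> independent {u, v} \<and> span {u, v} = P \<longrightarrow>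
      0 = g z (?R u v v) u / (g z u u * g z v v - (g z u v)\<^sup>2)"
      using flat g0 P(2) by simp
    show "k = 0" if "\<forall>u v. u \<noteq> v \<and> independent {u, v} \<and> span {u, v} = P \<longrightarrow>
      k = g z (?R u v v) u / (g z u u * g z v v - (g z u v)\<^sup>2)" for k
      using that[rule_format, of u v] uv B flat[of u v v] g0 P(2) by simp
  qed
qed

end

section \<open>Homogeneous Hessian metrics\<close>

text \<open>Symmetry of \<open>dderiv S u a *v v\<close> in \<open>u\<close> and \<open>v\<close> says that \<open>\<partial>\<^sub>k S\<^sub>i\<^sub>j\<close> is totally symmetric. That is the
  integrability condition for \<open>S\<close> to be locally the Hessian of a function. It is formulated on \<open>S\<close> itself
  because the inverse metric is then treated without first constructing its potential.\<close>

definition homogeneous_hessian_metric :: "(real^'n \<Rightarrow> real^'n^'n) \<Rightarrow> bool" where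
  "homogeneous_hessian_metric S \<longleftrightarrow> (\<forall>a. a \<noteq> 0 \<longrightarrow>
     S differentiable (at a) \<and> (\<forall>u. dderiv S u differentiable (at a)) \<and>
     transpose (S a) = S a \<and> invertible (S a) \<and>
     (\<forall>u v. dderiv S u a *v v = dderiv S v a *v u) \<and>
     (\<forall>t>0. S (t *\<^sub>R a) = S a))"

lemma homogeneous_hessian_metricD:
  assumes "homogeneous_hessian_metric S" "a \<noteq> 0"
  shows "S differentiable (at a)" "dderiv S u differentiable (at a)"
    "transpose (S a) = S a" "invertible (S a)"
    "dderiv S u a *v v = dderiv S v a *v u"
    "t > 0 \<Longrightarrow> S (t *\<^sub>R a) = S a"
  using assms unfolding homogeneous_hessian_metric_def by blast+

text \<open>For a totally symmetric \<open>\<partial>\<^sub>k S\<^sub>i\<^sub>j\<close> the three terms of the Koszul formula are equal up to sign, and this is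
  what remains: \<open>\<Gamma>\<^sup>k\<^sub>i\<^sub>j = 1/2 S\<^sup>k\<^sup>l \<partial>\<^sub>i S\<^sub>j\<^sub>l\<close>.\<close>

definition hessian_christoffel :: "(real^'n \<Rightarrow> real^'n^'n) \<Rightarrow> real^'n \<Rightarrow> real^'n \<Rightarrow> real^'n \<Rightarrow> real^'n" where
  "hessian_christoffel S a u v = (1/2) *\<^sub>R (matrix_inv (S a) *v (dderiv S u a *v v))"

lemma inner_matrix_symmetric:
  fixes A :: "real^'n^'n"
  assumes "transpose A = A"
  shows "x \<bullet> (A *v y) = (A *v x) \<bullet> y"
proof -
  have "A *v x = x v* A" using transpose_matrix_vector[of A x] unfolding assms .
  then show ?thesis by (simp add: dot_lmul_matrix)
qed

lemma transpose_dderiv: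
  fixes S :: "'a::real_normed_vector \<Rightarrow> real^'n^'n"
  assumes S: "S differentiable (at a)" and U: "open U" "a \<in> U" "\<And>b. b \<in> U \<Longrightarrow> transpose (S b) = S b"
  shows "transpose (dderiv S u a) = dderiv S u a"
proof -
  have "((\<lambda>b. S b $ i $ j) has_derivative (\<lambda>u. dderiv S u a $ j $ i)) (at a)" for i j
  proof (rule has_derivative_transform_within_open[OF has_derivative_matrix_nth[OF S] U(1,2)])
    show "S b $ j $ i = S b $ i $ j" if "b \<in> U" for b
      using arg_cong[OF U(3)[OF that], of "\<lambda>A. A $ j $ i"] by (simp add: transpose_def)
  qed
  then have "dderiv S u a $ j $ i = dderiv S u a $ i $ j" for i j
    using has_derivative_unique[OF _ has_derivative_matrix_nth[OF S]] by metis
  then show ?thesis by (simp add: transpose_def vec_eq_iff)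
qed

context
  fixes S :: "real^'n \<Rightarrow> real^'n^'n"
  assumes S: "homogeneous_hessian_metric S"
begin

lemma hessian_dderiv_symmetric: "a \<noteq> 0 \<Longrightarrow> transpose (dderiv S u a) = dderiv S u a"
  by (rule transpose_dderiv[of _ _ "- {0}"]) (auto intro: homogeneous_hessian_metricD[OF S])

lemma hessian_koszul:
  assumes "a \<noteq> 0"
  shows "hessian_christoffel S a u v \<bullet> (S a *v t)
    = 1/2 * (v \<bullet> (dderiv S u a *v t) + u \<bullet> (dderiv S v a *v t) - u \<bullet> (dderiv S t a *v v))"
proof -
  have S': "transpose (S a) = S a" "invertible (S a)" "dderiv S t a *v v = dderiv S v a *v t"
    by (fact homogeneous_hessian_metricD[OF S assms])+
  have "hessian_christoffel S a u v \<bullet> (S a *v t) = 1/2 * ((S a *v (matrix_inv (S a) *v (dderiv S u a *v v))) \<bullet> t)"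
    using S' by (simp add: hessian_christoffel_def inner_matrix_symmetric)
  also have "S a *v (matrix_inv (S a) *v (dderiv S u a *v v)) = dderiv S u a *v v"
    by (metis S'(2) matrix_inv_inverse(1) matrix_vector_mul_assoc matrix_vector_mul_lid)
  finally show ?thesis
    using S'(3) hessian_dderiv_symmetric[OF assms] by (simp add: inner_matrix_symmetric)
qed

lemma hessian_christoffel_linear1: "a \<noteq> 0 \<Longrightarrow> linear (\<lambda>u. hessian_christoffel S a u v)"
  using linear_dderiv[OF homogeneous_hessian_metricD(1)[OF S]] unfolding hessian_christoffel_def
  by (auto intro!: linearI simp: linear_add linear_cmul matrix_vector_mult_add_rdistrib
      matrix_vector_right_distrib scaleR_matrix_vector_assoc[symmetric] matrix_vector_mult_scaleR scaleR_right_distrib)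

lemma hessian_christoffel_linear2: "linear (hessian_christoffel S a u)"
  unfolding hessian_christoffel_def
  by (auto intro!: linearI simp: matrix_vector_right_distrib matrix_vector_mult_scaleR scaleR_right_distrib)

lemma hessian_christoffel_differentiable:
  assumes "a \<noteq> 0" shows "(\<lambda>a. hessian_christoffel S a u v) differentiable (at a)"
proof -
  have "(\<lambda>a. matrix_inv (S a)) differentiable (at a)" "dderiv S u differentiable (at a)"
    using homogeneous_hessian_metricD[OF S assms] by (auto intro: differentiable_matrix_inv)
  note d = this[THEN has_derivative_dderiv]
  show ?thesis
    unfolding hessian_christoffel_def differentiable_def
    by (rule exI, rule has_derivative_scaleR_right,
        rule bounded_bilinear.FDERIV[OF bounded_bilinear_matrix_vector_mult d(1)
          bounded_bilinear.FDERIV[OF bounded_bilinear_matrix_vector_mult d(2) has_derivative_const]])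
qed

text \<open>Euler's relation in degree zero, from which the Christoffel symbols inherit their radial identity.\<close>

lemma dderiv_hessian_radial:
  assumes "v \<noteq> 0" shows "dderiv S v v = 0"
proof -
  have "dderiv S v v = of_int 0 *\<^sub>R S v"
    by (rule euler_dderiv) (use homogeneous_hessian_metricD[OF S assms] in auto)
  then show ?thesis by simp
qed

lemma hessian_christoffel_radial: "a \<noteq> 0 \<Longrightarrow> hessian_christoffel S a a v = 0"
  by (simp add: hessian_christoffel_def dderiv_hessian_radial)

lemma hessian_christoffel_homogeneous:
  assumes "a \<noteq> 0" "t > 0"
  shows "hessian_christoffel S (t *\<^sub>R a) u v = inverse t *\<^sub>R hessian_christoffel S a u v"
proof -
  have "t *\<^sub>R dderiv S u (t *\<^sub>R a) = 1 *\<^sub>R dderiv S u a"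
    by (rule homogeneous_dderiv) (use homogeneous_hessian_metricD[OF S] assms in auto)
  then have "inverse t *\<^sub>R (t *\<^sub>R dderiv S u (t *\<^sub>R a)) = inverse t *\<^sub>R dderiv S u a" by simp
  then have "dderiv S u (t *\<^sub>R a) = inverse t *\<^sub>R dderiv S u a" using assms by simp
  then show ?thesis
    using homogeneous_hessian_metricD(6)[OF S assms] by (simp add: hessian_christoffel_def
        scaleR_matrix_vector_assoc[symmetric] matrix_vector_mult_scaleR)
qed

end

fun block_metric :: "(real^'n \<Rightarrow> real^'n^'n) \<Rightarrow> (real^'m \<Rightarrow> real^'m^'m) \<Rightarrow>
    (real^'n) \<times> (real^'m) \<Rightarrow> (real^'n) \<times> (real^'m) \<Rightarrow> (real^'n) \<times> (real^'m) \<Rightarrow> real" where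
  "block_metric S S' (v, w) (X1, X2) (Y1, Y2) = X1 \<bullet> (S v *v Y1) + X2 \<bullet> (S' w *v Y2)"

lemma dderiv_block_metric:
  assumes "S differentiable (at (fst q))" "S' differentiable (at (snd q))"
  shows "dderiv (\<lambda>a. block_metric S S' a X Y) u q
    = fst X \<bullet> (dderiv S (fst u) (fst q) *v fst Y) + snd X \<bullet> (dderiv S' (snd u) (snd q) *v snd Y)"
proof (rule dderiv_eqI)
  have eq: "(\<lambda>a. block_metric S S' a X Y)
      = (\<lambda>a. fst X \<bullet> (S (fst a) *v fst Y) + snd X \<bullet> (S' (snd a) *v snd Y))"
    by (cases X; cases Y) (auto simp: fun_eq_iff)
  have S: "((\<lambda>a. S (fst a)) has_derivative (\<lambda>u. dderiv S (fst u) (fst q))) (at q)"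
    by (rule has_derivative_compose[OF has_derivative_fst[OF has_derivative_ident] has_derivative_dderiv[OF assms(1)]])
  have S': "((\<lambda>a. S' (snd a)) has_derivative (\<lambda>u. dderiv S' (snd u) (snd q))) (at q)"
    by (rule has_derivative_compose[OF has_derivative_snd[OF has_derivative_ident] has_derivative_dderiv[OF assms(2)]])
  note mv = bounded_bilinear.bounded_linear_left[OF bounded_bilinear_matrix_vector_mult]
  show "((\<lambda>a. block_metric S S' a X Y) has_derivative (\<lambda>u. fst X \<bullet> (dderiv S (fst u) (fst q) *v fst Y)
      + snd X \<bullet> (dderiv S' (snd u) (snd q) *v snd Y))) (at q)"
    unfolding eq
    by (intro has_derivative_add has_derivative_inner_right bounded_linear.has_derivative[OF mv] S S')
qed

lemma block_metric_nondegenerate: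
  assumes S: "transpose (S v) = S v" "invertible (S v)" and S': "transpose (S' w) = S' w" "invertible (S' w)"
    and eq: "\<And>t. block_metric S S' (v, w) X t = block_metric S S' (v, w) Y t"
  shows "X = Y"
proof -
  have inj: "x = y" if A: "transpose A = A" "invertible A" and e: "\<And>t. x \<bullet> (A *v t) = y \<bullet> (A *v t)"
    for A :: "real^'k^'k" and x y
  proof -
    have "(A *v x - A *v y) \<bullet> t = 0" for t
      using e[of t] A by (simp add: inner_matrix_symmetric inner_diff_left)
    then have "A *v x = A *v y" by (metis inner_eq_zero_iff right_minus_eq)
    then show ?thesis using inj_matrix_vector_mult[OF A(2)] by (simp add: inj_eq)
  qed
  obtain X1 X2 Y1 Y2 where XY: "X = (X1, X2)" "Y = (Y1, Y2)" by (metis surj_pair)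
  have "X1 = Y1" by (rule inj[OF S]) (use eq[of "(t, 0)" for t] XY in simp)
  moreover have "X2 = Y2" by (rule inj[OF S']) (use eq[of "(0, t)" for t] XY in simp)
  ultimately show ?thesis by (simp add: XY)
qed

text \<open>The metric is a product, so its connection splits. Nondegeneracy of both blocks makes the solution of
  the Koszul formula unique.\<close>

lemma christoffel_block_metric:
  assumes S: "homogeneous_hessian_metric S" and S': "homogeneous_hessian_metric S'"
    and a: "a \<in> (- {0}) \<times> (- {0})"
  shows "christoffel (block_metric S S') a u v
    = (hessian_christoffel S (fst a) (fst u) (fst v), hessian_christoffel S' (snd a) (snd u) (snd v))"
proof -
  obtain a1 a2 u1 u2 v1 v2 where auv: "a = (a1, a2)" "u = (u1, u2)" "v = (v1, v2)" by (metis surj_pair)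
  have nz: "a1 \<noteq> 0" "a2 \<noteq> 0" using a by (auto simp: auv)
  note d = homogeneous_hessian_metricD[OF S nz(1)] homogeneous_hessian_metricD[OF S' nz(2)]
  let ?w = "(hessian_christoffel S a1 u1 v1, hessian_christoffel S' a2 u2 v2)"
  let ?rhs = "\<lambda>t. 1/2 * (dderiv (\<lambda>a. block_metric S S' a v t) u a + dderiv (\<lambda>a. block_metric S S' a u t) v a
      - dderiv (\<lambda>a. block_metric S S' a u v) t a)"
  have w: "block_metric S S' a ?w t = ?rhs t" for t
  proof -
    obtain t1 t2 where t: "t = (t1, t2)" by (metis surj_pair)
    show ?thesis unfolding auv t
      by (simp add: d(1) d(7) dderiv_block_metric hessian_koszul[OF S nz(1)] hessian_koszul[OF S' nz(2)]
          add_divide_distrib diff_divide_distrib)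
  qed
  have "christoffel (block_metric S S') a u v = ?w"
    unfolding christoffel_def
  proof (rule the_equality)
    show "\<forall>t. block_metric S S' a ?w t = ?rhs t" using w by blast
    show "w' = ?w" if "\<forall>t. block_metric S S' a w' t = ?rhs t" for w'
    proof (rule block_metric_nondegenerate[of S a1 S' a2])
      show "block_metric S S' (a1, a2) w' t = block_metric S S' (a1, a2) ?w t" for t
        using that w[of t] unfolding auv by metis
    qed (fact d)+
  qed
  then show ?thesis by (simp add: auv)
qed

lemma sectional_curvature_block_metric:
  fixes S :: "real^'n \<Rightarrow> real^'n^'n" and S' :: "real^'m \<Rightarrow> real^'m^'m"
  assumes S: "homogeneous_hessian_metric S" and S': "homogeneous_hessian_metric S'"
    and z: "fst z \<noteq> 0" "snd z \<noteq> 0" and P: "plane_section P" "z \<in> P"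
  shows "sectional_curvature (block_metric S S') z P = 0"
proof -
  let ?\<Gamma> = "\<lambda>a u v. (hessian_christoffel S (fst a) (fst u) (fst v), hessian_christoffel S' (snd a) (snd u) (snd v))"
  interpret radially_flat_connection "block_metric S S'" ?\<Gamma> "(- {0}) \<times> (- {0})" z
  proof (rule radially_flat_connection.intro)
    show "open ((- {0::real^'n}) \<times> (- {0::real^'m}))" by (intro open_Times) auto
    show "z \<in> (- {0}) \<times> (- {0})" using z by (simp add: mem_Times_iff)
    show "christoffel (block_metric S S') a u v = ?\<Gamma> a u v" if "a \<in> (- {0}) \<times> (- {0})" for a u v
      using christoffel_block_metric[OF S S' that] .
    show "linear (\<lambda>u. ?\<Gamma> a u v)" if "a \<in> (- {0}) \<times> (- {0})" for a v
    proof -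
      have a: "fst a \<noteq> 0" "snd a \<noteq> 0" using that by (auto simp: mem_Times_iff)
      note L = hessian_christoffel_linear1[OF S a(1)] hessian_christoffel_linear1[OF S' a(2)]
      show ?thesis
        by (rule linearI) (simp_all add: L[THEN linear_add] L[THEN linear_cmul])
    qed
    show "linear (?\<Gamma> a u)" if "a \<in> (- {0}) \<times> (- {0})" for a u
      using hessian_christoffel_linear2[OF S, of "fst a"] hessian_christoffel_linear2[OF S', of "snd a"]
      by (intro linearI) (auto simp: linear_add linear_cmul)
    show "(\<lambda>a. ?\<Gamma> a u v) differentiable (at z)" for u v
    proof -
      have "((\<lambda>a. hessian_christoffel S (fst a) (fst u) (fst v)) has_derivative
          (\<lambda>h. dderiv (\<lambda>b. hessian_christoffel S b (fst u) (fst v)) (fst h) (fst z))) (at z)"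
        by (rule has_derivative_compose[OF has_derivative_fst[OF has_derivative_ident] has_derivative_dderiv])
          (rule hessian_christoffel_differentiable[OF S z(1)])
      moreover have "((\<lambda>a. hessian_christoffel S' (snd a) (snd u) (snd v)) has_derivative
          (\<lambda>h. dderiv (\<lambda>b. hessian_christoffel S' b (snd u) (snd v)) (snd h) (snd z))) (at z)"
        by (rule has_derivative_compose[OF has_derivative_snd[OF has_derivative_ident] has_derivative_dderiv])
          (rule hessian_christoffel_differentiable[OF S' z(2)])
      ultimately have "((\<lambda>a. ?\<Gamma> a u v) has_derivative
          (\<lambda>h. (dderiv (\<lambda>b. hessian_christoffel S b (fst u) (fst v)) (fst h) (fst z),
             dderiv (\<lambda>b. hessian_christoffel S' b (snd u) (snd v)) (snd h) (snd z)))) (at z)"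
        by (rule has_derivative_Pair)
      then show ?thesis by (rule differentiableI)
    qed
  qed (use z hessian_christoffel_radial[OF S] hessian_christoffel_radial[OF S']
        hessian_christoffel_homogeneous[OF S] hessian_christoffel_homogeneous[OF S'] in
        \<open>auto simp: mem_Times_iff zero_prod_def\<close>)
  have "block_metric S S' z 0 u = 0" for u
    by (cases z; cases u) (simp add: zero_prod_def)
  moreover have "z \<noteq> 0" using z(1) by auto
  ultimately show ?thesis by (intro sectional_curvature_zero[OF P])
qed

text \<open>The value of a fundamental matrix at the origin carries no information, so metrics are only identified
  away from it.\<close>

lemma homogeneous_hessian_metric_cong:
  assumes S: "homogeneous_hessian_metric S" and eq: "\<And>a. a \<noteq> 0 \<Longrightarrow> S a = S' a"
  shows "homogeneous_hessian_metric S'"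
  unfolding homogeneous_hessian_metric_def
proof (intro allI impI)
  fix a :: "real^'a" assume a: "a \<noteq> 0"
  note d = homogeneous_hessian_metricD[OF S]
  have O: "open (- {0 :: real^'a})" by auto
  have D: "dderiv S u b = dderiv S' u b" if "b \<noteq> 0" for u b
    by (rule dderiv_cong_open[OF d(1) O]) (use that eq in auto)
  have 1: "S' differentiable (at a)"
    by (rule differentiable_cong_open[OF d(1) O]) (use a eq in auto)
  have 2: "dderiv S' u differentiable (at a)" for u
    by (rule differentiable_cong_open[OF d(2) O]) (use a D in auto)
  have 3: "transpose (S' a) = S' a" "invertible (S' a)" using d[OF a] eq[OF a] by simp_all
  have 4: "dderiv S' u a *v v = dderiv S' v a *v u" for u v
    using d(5)[OF a] D[OF a] by simp
  have 5: "S' (t *\<^sub>R a) = S' a" if "t > 0" for t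
    using d(6)[OF a that] eq[OF a] eq[of "t *\<^sub>R a"] a that by simp
  show "S' differentiable (at a) \<and> (\<forall>u. dderiv S' u differentiable (at a)) \<and>
     transpose (S' a) = S' a \<and> invertible (S' a) \<and>
     (\<forall>u v. dderiv S' u a *v v = dderiv S' v a *v u) \<and>
     (\<forall>t>0. S' (t *\<^sub>R a) = S' a)"
    using 1 2 3 4 5 by blast
qed

section \<open>The Legendre transformation\<close>

definition legendre :: "(real^'n \<Rightarrow> real^'n^'n) \<Rightarrow> real^'n \<Rightarrow> real^'n" where
  "legendre S v = S v *v v"

context
  fixes S :: "real^'n \<Rightarrow> real^'n^'n"
  assumes S: "homogeneous_hessian_metric S"
begin

text \<open>By the product rule the derivative is \<open>S v *v u + dderiv S u v *v v\<close>. Total symmetry turns the second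
  term into \<open>dderiv S v v *v u\<close>, which is zero by Euler's relation.\<close>

lemma legendre_has_derivative:
  assumes v: "v \<noteq> 0"
  shows "(legendre S has_derivative (*v) (S v)) (at v)"
proof -
  have "((\<lambda>v. S v *v v) has_derivative (\<lambda>u. S v *v u + dderiv S u v *v v)) (at v)"
    by (intro bounded_bilinear.FDERIV[OF bounded_bilinear_matrix_vector_mult] has_derivative_dderiv
        has_derivative_ident homogeneous_hessian_metricD(1)[OF S v])
  moreover have "dderiv S u v *v v = 0" for u
    using homogeneous_hessian_metricD(5)[OF S v, of u v] dderiv_hessian_radial[OF S v] by simp
  ultimately show ?thesis by (simp add: legendre_def[abs_def])
qed

lemma legendre_scaleR: "v \<noteq> 0 \<Longrightarrow> t > 0 \<Longrightarrow> legendre S (t *\<^sub>R v) = t *\<^sub>R legendre S v"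
  using homogeneous_hessian_metricD(6)[OF S] by (simp add: legendre_def matrix_vector_mult_scaleR)

end

text \<open>The inverse \<open>q\<close> of the Legendre map is taken as a parameter: its existence depends on the norm, while the
  differential geometry of the inverse metric in the dual coordinates does not.\<close>

locale dual_hessian_metric =
  fixes S :: "real^'n \<Rightarrow> real^'n^'n" and q :: "real^'n \<Rightarrow> real^'n"
  assumes S: "homogeneous_hessian_metric S"
    and q_nonzero: "w \<noteq> 0 \<Longrightarrow> q w \<noteq> 0"
    and legendre_q: "w \<noteq> 0 \<Longrightarrow> legendre S (q w) = w"
    and q_legendre: "v \<noteq> 0 \<Longrightarrow> q (legendre S v) = v"
begin

abbreviation T where "T w \<equiv> matrix_inv (S (q w))"

lemma invertible_S: "v \<noteq> 0 \<Longrightarrow> invertible (S v)"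
  using homogeneous_hessian_metricD(4)[OF S] .

lemma T_symmetric: "w \<noteq> 0 \<Longrightarrow> transpose (T w) = T w"
  using homogeneous_hessian_metricD(3)[OF S] transpose_matrix_inv invertible_S q_nonzero by blast

lemma T_mult: "w \<noteq> 0 \<Longrightarrow> T w *v w = q w"
  using legendre_q[of w] matrix_inv_inverse(2)[OF invertible_S, of "q w"] q_nonzero[of w]
  by (metis legendre_def matrix_vector_mul_assoc matrix_vector_mul_lid)

lemma q_has_derivative:
  assumes w: "w \<noteq> 0"
  shows "(q has_derivative (*v) (T w)) (at w)"
proof (rule has_derivative_inverse_strong_x[of "- {0}" q w "legendre S" "(*v) (S (q w))"])
  show "continuous_on (- {0}) (legendre S)"
    using legendre_has_derivative[OF S] has_derivative_continuous
    by (intro continuous_at_imp_continuous_on) blast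
  show "(*v) (S (q w)) \<circ> (*v) (T w) = id"
    using matrix_inv_inverse(1)[OF invertible_S[OF q_nonzero[OF w]]]
    by (auto simp: matrix_vector_mul_assoc)
qed (use w q_nonzero legendre_q q_legendre legendre_has_derivative[OF S] in auto)

lemma T_has_derivative:
  assumes w: "w \<noteq> 0"
  shows "(T has_derivative (\<lambda>u. - (T w ** dderiv S (T w *v u) (q w) ** T w))) (at w)"
proof -
  note d = homogeneous_hessian_metricD[OF S]
  have inv: "(\<lambda>v. matrix_inv (S v)) differentiable (at (q w))"
    using d(1,4) q_nonzero[OF w] by (intro differentiable_matrix_inv) auto
  have "dderiv (\<lambda>v. matrix_inv (S v)) u (q w) = - (T w ** dderiv S u (q w) ** T w)" for u
    by (rule dderiv_matrix_inv[OF d(1), of _ "- {0}"]) (use q_nonzero[OF w] d(4) in auto)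
  then show ?thesis
    using has_derivative_compose[OF q_has_derivative[OF w] has_derivative_dderiv[OF inv]] by simp
qed

text \<open>From \<open>dderiv q u = T *v u\<close> and the derivative of the matrix inverse,
  \<open>dderiv T u *v v = - T *v (dderiv S (T *v u) *v (T *v v))\<close>, so total symmetry is inherited from \<open>S\<close>. The same
  formula, with \<open>dderiv S (T *v u)\<close> expanded in a basis, exhibits the second derivatives of \<open>T\<close>.\<close>

lemma dual_is_hessian: "homogeneous_hessian_metric T"
  unfolding homogeneous_hessian_metric_def
proof (intro allI impI)
  fix w :: "real^'n" assume w: "w \<noteq> 0"
  note d = homogeneous_hessian_metricD[OF S]
  have dT: "dderiv T u b = - (T b ** dderiv S (T b *v u) (q b) ** T b)" if "b \<noteq> 0" for u b
    using dderiv_eqI[OF T_has_derivative[OF that]] .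
  have 1: "T differentiable (at w)" using T_has_derivative[OF w] by (auto simp: differentiable_def)
  have 2: "dderiv T u differentiable (at w)" for u
  proof -
    have expand: "dderiv S (T b *v u) (q b) = (\<Sum>e\<in>Basis. ((T b *v u) \<bullet> e) *\<^sub>R dderiv S e (q b))"
      if "b \<noteq> 0" for b
      by (rule linear_expansion[OF linear_dderiv[OF d(1)[OF q_nonzero[OF that]]]])
    have Tu: "((\<lambda>b. T b *v u) has_derivative (\<lambda>h. dderiv T h w *v u)) (at w)"
      by (intro bounded_linear.has_derivative[OF bounded_bilinear.bounded_linear_left[OF bounded_bilinear_matrix_vector_mult]]
          has_derivative_dderiv[OF 1])
    have Se: "((\<lambda>b. dderiv S e (q b)) has_derivative (\<lambda>h. dderiv (dderiv S e) (T w *v h) (q w))) (at w)" for e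
      by (rule has_derivative_compose[OF q_has_derivative[OF w] has_derivative_dderiv[OF d(2)[OF q_nonzero[OF w]]]])
    have "(\<lambda>b. (\<Sum>e\<in>Basis. ((T b *v u) \<bullet> e) *\<^sub>R dderiv S e (q b))) differentiable (at w)"
    proof (rule differentiable_sum[OF finite_Basis], rule ballI)
      fix e :: "real^'n"
      have "(\<lambda>b. (T b *v u) \<bullet> e) differentiable (at w)"
        by (rule differentiableI[OF has_derivative_inner_left[OF Tu]])
      then show "(\<lambda>b. ((T b *v u) \<bullet> e) *\<^sub>R dderiv S e (q b)) differentiable (at w)"
        using differentiableI[OF Se] by (rule differentiable_scaleR)
    qed
    then have "(\<lambda>b. - (T b ** (\<Sum>e\<in>Basis. ((T b *v u) \<bullet> e) *\<^sub>R dderiv S e (q b)) ** T b)) differentiable (at w)"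
      by (intro differentiable_minus differentiable_matrix_matrix_mult 1)
    then show ?thesis
      by (rule differentiable_cong_open[where S = "- {0}"]) (use w in \<open>simp_all add: dT expand open_Compl\<close>)
  qed
  have 3: "invertible (T w)"
    using matrix_inv_inverse[OF invertible_S[OF q_nonzero[OF w]]] unfolding invertible_def by blast
  have 4: "dderiv T u w *v v = dderiv T v w *v u" for u v
  proof -
    have "dderiv T u w *v v = - (T w *v (dderiv S (T w *v u) (q w) *v (T w *v v)))" for u v
      unfolding dT[OF w]
      by (simp add: bounded_bilinear.minus_left[OF bounded_bilinear_matrix_vector_mult]
          flip: matrix_vector_mul_assoc)
    then show ?thesis using d(5)[OF q_nonzero[OF w]] by metis
  qed
  have 5: "T (t *\<^sub>R w) = T w" if t: "t > 0" for t
  proof -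
    have "legendre S (t *\<^sub>R q w) = t *\<^sub>R w"
      using legendre_scaleR[OF S q_nonzero[OF w] t] legendre_q[OF w] by simp
    then have "q (t *\<^sub>R w) = t *\<^sub>R q w"
      using q_legendre[of "t *\<^sub>R q w"] q_nonzero[OF w] t by simp
    then show ?thesis using d(6)[OF q_nonzero[OF w] t] by simp
  qed
  show "T differentiable (at w) \<and> (\<forall>u. dderiv T u differentiable (at w)) \<and>
     transpose (T w) = T w \<and> invertible (T w) \<and>
     (\<forall>u v. dderiv T u w *v v = dderiv T v w *v u) \<and> (\<forall>t>0. T (t *\<^sub>R w) = T w)"
    using 1 2 3 4 5 T_symmetric[OF w] by blast
qed

end

section \<open>Minkowski norms\<close>

lemma linear_expansion_axis:
  fixes l :: "real^'n \<Rightarrow> 'b::real_vector"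
  assumes "linear l"
  shows "l y = (\<Sum>j\<in>UNIV. y $ j *\<^sub>R l (axis j 1))"
proof -
  have "y = (\<Sum>j\<in>UNIV. y $ j *\<^sub>R axis j 1)"
    using basis_expansion[of y] by (simp add: scalar_mult_eq_scaleR)
  then have "l y = l (\<Sum>j\<in>UNIV. y $ j *\<^sub>R axis j 1)" by simp
  then show ?thesis using assms by (simp add: linear_sum linear_cmul)
qed

text \<open>The restriction of a Finsler structure to one tangent space.\<close>

locale minkowski_norm =
  fixes f :: "real^'n \<Rightarrow> real"
  assumes smooth: "smooth_on (- {0}) f"
    and nonneg: "f v \<ge> 0"
    and homogeneous: "t > 0 \<Longrightarrow> f (t *\<^sub>R v) = t * f v"
    and posdef: "v \<noteq> 0 \<Longrightarrow> u \<noteq> 0 \<Longrightarrow> u \<bullet> (fundamental_matrix f v *v u) > 0"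
begin

abbreviation \<phi> where "\<phi> \<equiv> \<lambda>v. (f v)\<^sup>2"
abbreviation S where "S \<equiv> fundamental_matrix f"

lemma open_punctured: "open (- {0 :: real^'n})" by auto

lemma smooth_square: "smooth_on (- {0}) \<phi>"
  using smooth Ck_on_mult[OF open_punctured, of _ f f]
  by (simp add: smooth_on_def power2_eq_square)

lemmas smooth_dderiv = smooth_square[THEN smooth_on_dderiv]
lemmas smooth_dderiv2 = smooth_dderiv[THEN smooth_on_dderiv]

lemma commute_dderiv:
  fixes k :: "real^'n \<Rightarrow> real"
  assumes "smooth_on (- {0}) k" "v \<noteq> 0"
  shows "dderiv (dderiv k x) y v = dderiv (dderiv k y) x v"
  using dderiv_commute[OF open_punctured, of v k x y] assms unfolding smooth_on_def by blast

lemma diff_square: "v \<noteq> 0 \<Longrightarrow> \<phi> differentiable (at v)"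
  "v \<noteq> 0 \<Longrightarrow> dderiv \<phi> x differentiable (at v)"
  "v \<noteq> 0 \<Longrightarrow> dderiv (dderiv \<phi> x) y differentiable (at v)"
  using smooth_on_differentiable[OF smooth_square] smooth_on_differentiable[OF smooth_dderiv]
    smooth_on_differentiable[OF smooth_dderiv2] by auto

text \<open>The fundamental matrix is half the Hessian of the squared norm as a bilinear form. In this coordinate-free
  form all symmetries become instances of the commutation of derivatives.\<close>

lemma inner_fundamental:
  assumes v: "v \<noteq> 0"
  shows "x \<bullet> (S v *v y) = 1/2 * dderiv (dderiv \<phi> y) x v"
proof -
  let ?e = "\<lambda>i. axis i 1 :: real^'n"
  have "((\<lambda>z. \<Sum>j\<in>UNIV. y $ j *\<^sub>R dderiv \<phi> (?e j) z) has_derivative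
      (\<lambda>x. \<Sum>j\<in>UNIV. y $ j *\<^sub>R dderiv (dderiv \<phi> (?e j)) x v)) (at v)"
    by (intro has_derivative_sum has_derivative_scaleR_right has_derivative_dderiv diff_square v)
  then have "(dderiv \<phi> y has_derivative
      (\<lambda>x. \<Sum>j\<in>UNIV. y $ j *\<^sub>R dderiv (dderiv \<phi> (?e j)) x v)) (at v)"
    by (rule has_derivative_transform_within_open[OF _ open_punctured])
      (use v linear_expansion_axis[OF linear_dderiv[OF diff_square(1)], symmetric] in auto)
  then have "dderiv (dderiv \<phi> y) x v = (\<Sum>j\<in>UNIV. y $ j *\<^sub>R dderiv (dderiv \<phi> (?e j)) x v)"
    by (rule dderiv_eqI)
  also have "\<dots> = (\<Sum>j\<in>UNIV. y $ j *\<^sub>R (\<Sum>i\<in>UNIV. x $ i *\<^sub>R dderiv (dderiv \<phi> (?e j)) (?e i) v))"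
    using linear_expansion_axis[OF linear_dderiv[OF diff_square(2)[OF v]], of _ x] by simp
  also have "\<dots> = (\<Sum>i\<in>UNIV. \<Sum>j\<in>UNIV. x $ i * (y $ j * dderiv (dderiv \<phi> (?e j)) (?e i) v))"
    by (simp add: sum_distrib_left) (subst sum.swap, simp add: algebra_simps)
  also have "\<dots> = 2 * (x \<bullet> (S v *v y))"
    by (simp add: inner_vec_def matrix_vector_mult_def fundamental_matrix_def sum_distrib_left algebra_simps)
  finally show ?thesis by simp
qed

lemma fundamental_nth: "S v $ i $ j = 1/2 * dderiv (dderiv \<phi> (axis j 1)) (axis i 1) v"
  by (simp add: fundamental_matrix_def)

lemma S_differentiable: "v \<noteq> 0 \<Longrightarrow> S differentiable (at v)"
  by (rule differentiable_matrixI) (simp only: fundamental_nth, intro differentiable_mult differentiable_const diff_square)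

lemma inner_dderiv_fundamental:
  assumes v: "v \<noteq> 0"
  shows "x \<bullet> (dderiv S u v *v y) = 1/2 * dderiv (dderiv (dderiv \<phi> y) x) u v"
proof -
  have "((\<lambda>v. x \<bullet> (S v *v y)) has_derivative (\<lambda>u. x \<bullet> (dderiv S u v *v y))) (at v)"
    by (intro has_derivative_inner_right has_derivative_dderiv S_differentiable v
        bounded_linear.has_derivative[OF bounded_bilinear.bounded_linear_left[OF bounded_bilinear_matrix_vector_mult]])
  then have 1: "((\<lambda>v. 1/2 * dderiv (dderiv \<phi> y) x v) has_derivative (\<lambda>u. x \<bullet> (dderiv S u v *v y))) (at v)"
    by (rule has_derivative_transform_within_open[OF _ open_punctured]) (use v inner_fundamental in auto)
  have 2: "((\<lambda>v. 1/2 * dderiv (dderiv \<phi> y) x v) has_derivative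
      (\<lambda>u. 1/2 * dderiv (dderiv (dderiv \<phi> y) x) u v)) (at v)"
    by (intro has_derivative_mult_right has_derivative_dderiv diff_square v)
  show ?thesis using fun_cong[OF has_derivative_unique[OF 1 2], of u] .
qed

lemma invertible_fundamental:
  assumes "v \<noteq> 0" shows "invertible (S v)"
  unfolding invertible_left_inverse matrix_left_invertible_ker
  using posdef[OF assms] by (metis inner_zero_right less_irrefl)

text \<open>Total symmetry of the third derivatives of \<open>\<phi>\<close>, and degree zero of its second derivatives.\<close>

lemma hessian: "homogeneous_hessian_metric S"
  unfolding homogeneous_hessian_metric_def
proof (intro allI impI)
  fix a :: "real^'n" assume a: "a \<noteq> 0"
  have 2: "dderiv S u differentiable (at a)" for u
  proof (rule differentiable_matrixI)
    fix i j
    have "(\<lambda>b. 1/2 * dderiv (dderiv (dderiv \<phi> (axis j 1)) (axis i 1)) u b) differentiable (at a)"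
      using smooth_on_differentiable[OF smooth_dderiv2[THEN smooth_on_dderiv]] a
      by (intro differentiable_mult differentiable_const) auto
    then show "(\<lambda>b. dderiv S u b $ i $ j) differentiable (at a)"
    proof (rule differentiable_cong_open[OF _ open_punctured])
      fix b :: "real^'n" assume b: "b \<in> - {0}"
      have "dderiv S u b $ i $ j = axis i 1 \<bullet> (dderiv S u b *v axis j 1)"
        by (simp add: inner_axis' matrix_vector_mul_component inner_axis)
      then show "1/2 * dderiv (dderiv (dderiv \<phi> (axis j 1)) (axis i 1)) u b = dderiv S u b $ i $ j"
        using inner_dderiv_fundamental[of b] b by simp
    qed (use a in simp)
  qed
  have 3: "transpose (S a) = S a"
    using commute_dderiv[OF smooth_square a] by (simp add: vec_eq_iff transpose_def fundamental_nth)
  have 5: "dderiv S u a *v y = dderiv S y a *v u" for u y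
  proof -
    have "x \<bullet> (dderiv S u a *v y) = x \<bullet> (dderiv S y a *v u)" for x
    proof -
      have "dderiv (dderiv (dderiv \<phi> y) x) u a = dderiv (dderiv (dderiv \<phi> y) u) x a"
        by (rule commute_dderiv[OF smooth_dderiv a])
      also have "\<dots> = dderiv (dderiv (dderiv \<phi> u) y) x a"
        by (rule dderiv_cong_open[OF _ open_punctured])
          (use a diff_square commute_dderiv[OF smooth_square] in auto)
      also have "\<dots> = dderiv (dderiv (dderiv \<phi> u) x) y a"
        by (rule commute_dderiv[OF smooth_dderiv a])
      finally show ?thesis
        using inner_dderiv_fundamental[OF a, of x u y] inner_dderiv_fundamental[OF a, of x y u] by simp
    qed
    then show ?thesis using vector_eq_ldot by blast
  qed
  have 6: "S (t *\<^sub>R a) = S a" if t: "t > 0" for t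
  proof -
    have "\<phi> (t *\<^sub>R w) = t\<^sup>2 *\<^sub>R \<phi> w" for w
      using homogeneous[OF t] by (simp add: power_mult_distrib)
    then have "t *\<^sub>R dderiv \<phi> x (t *\<^sub>R w) = t\<^sup>2 *\<^sub>R dderiv \<phi> x w" if "w \<noteq> 0" for x w
      using homogeneous_dderiv[of \<phi> t "t\<^sup>2" w x] diff_square that t by auto
    then have "dderiv \<phi> x (t *\<^sub>R w) = t *\<^sub>R dderiv \<phi> x w" if "w \<noteq> 0" for x w
      using that t by (simp add: power2_eq_square)
    then have "t *\<^sub>R dderiv (dderiv \<phi> x) y (t *\<^sub>R a) = t *\<^sub>R dderiv (dderiv \<phi> x) y a" for x y
      using homogeneous_dderiv[of "dderiv \<phi> x" t t a y] diff_square a t by auto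
    then show ?thesis using t by (simp add: vec_eq_iff fundamental_nth)
  qed
  show "S differentiable (at a) \<and> (\<forall>u. dderiv S u differentiable (at a)) \<and>
     transpose (S a) = S a \<and> invertible (S a) \<and>
     (\<forall>u v. dderiv S u a *v v = dderiv S v a *v u) \<and> (\<forall>t>0. S (t *\<^sub>R a) = S a)"
    using S_differentiable[OF a] 2 3 invertible_fundamental[OF a] 5 6 by blast
qed

abbreviation \<L> where "\<L> \<equiv> legendre S"

text \<open>Euler's relation identifies the Legendre map with half the gradient of the squared norm.\<close>

lemma inner_legendre:
  assumes v: "v \<noteq> 0"
  shows "x \<bullet> \<L> v = 1/2 * dderiv \<phi> x v"
proof -
  have "dderiv \<phi> x (t *\<^sub>R v) = t powi 1 *\<^sub>R dderiv \<phi> x v" if t: "t > 0" for t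
  proof -
    have "t *\<^sub>R dderiv \<phi> x (t *\<^sub>R v) = t\<^sup>2 *\<^sub>R dderiv \<phi> x v"
      by (rule homogeneous_dderiv) (use homogeneous[OF t] diff_square v t in \<open>auto simp: power_mult_distrib\<close>)
    then show ?thesis using t by (simp add: power2_eq_square)
  qed
  then have "dderiv (dderiv \<phi> x) v v = of_int 1 *\<^sub>R dderiv \<phi> x v"
    using diff_square(2)[OF v] by (intro euler_dderiv) auto
  then show ?thesis
    unfolding legendre_def inner_fundamental[OF v] by (simp add: commute_dderiv[OF smooth_square v, of v x])
qed

lemma inner_legendre_self: "v \<noteq> 0 \<Longrightarrow> v \<bullet> \<L> v = \<phi> v"
proof -
  assume v: "v \<noteq> 0"
  have "dderiv \<phi> v v = of_int 2 *\<^sub>R \<phi> v"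
    by (rule euler_dderiv) (use homogeneous diff_square(1)[OF v] in \<open>auto simp: power_mult_distrib power_int_def\<close>)
  then show ?thesis using inner_legendre[OF v, of v] by simp
qed

lemma positive: "v \<noteq> 0 \<Longrightarrow> f v > 0"
  using inner_legendre_self[of v] posdef[of v v] nonneg[of v]
  by (metis legendre_def less_eq_real_def order.irrefl zero_power2)

lemma legendre_nonzero: "v \<noteq> 0 \<Longrightarrow> \<L> v \<noteq> 0"
  using inner_legendre_self[of v] positive[of v] by auto

text \<open>Strict monotonicity of the gradient of a strictly convex function, obtained along the segment from \<open>w\<close> to
  \<open>v\<close>. The squared norm need not be twice differentiable at the origin, so a segment through it needs its own argument:
  then \<open>v\<close> and \<open>w\<close> are opposite, while both pair positively with the common image.\<close>

lemma legendre_injective: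
  assumes v: "v \<noteq> 0" and w: "w \<noteq> 0" and eq: "\<L> v = \<L> w"
  shows "v = w"
proof (rule ccontr)
  assume ne: "v \<noteq> w"
  let ?\<gamma> = "\<lambda>t::real. w + t *\<^sub>R (v - w)"
  consider (avoid) "\<forall>t\<in>{0..1}. ?\<gamma> t \<noteq> 0" | (meet) t where "0 \<le> t" "t \<le> 1" "?\<gamma> t = 0" by (metis atLeastAtMost_iff)
  then show False
  proof cases
    case avoid
    have "\<exists>y. ((\<lambda>t. \<L> (?\<gamma> t) \<bullet> (v - w)) has_real_derivative y) (at t) \<and> 0 < y"
      if "0 \<le> t" "t \<le> 1" for t
    proof -
      have \<gamma>: "(?\<gamma> has_derivative (\<lambda>h. h *\<^sub>R (v - w))) (at t)"
        by (auto intro!: derivative_eq_intros)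
      have nz: "?\<gamma> t \<noteq> 0" using avoid that by auto
      have "((\<lambda>t. \<L> (?\<gamma> t) \<bullet> (v - w)) has_derivative (\<lambda>h. (S (?\<gamma> t) *v (h *\<^sub>R (v - w))) \<bullet> (v - w))) (at t)"
        by (intro has_derivative_inner_left has_derivative_compose[OF \<gamma>] legendre_has_derivative[OF hessian nz])
      moreover have "(\<lambda>h. (S (?\<gamma> t) *v (h *\<^sub>R (v - w))) \<bullet> (v - w)) = (*) ((v - w) \<bullet> (S (?\<gamma> t) *v (v - w)))"
        by (auto simp: fun_eq_iff matrix_vector_mult_scaleR inner_commute)
      ultimately show ?thesis
        using posdef[OF nz, of "v - w"] ne unfolding has_field_derivative_def by auto
    qed
    then have "\<L> (?\<gamma> 0) \<bullet> (v - w) < \<L> (?\<gamma> 1) \<bullet> (v - w)"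
      using DERIV_pos_imp_increasing[of 0 1 "\<lambda>t. \<L> (?\<gamma> t) \<bullet> (v - w)"] by simp
    then show False using eq by simp
  next
    case meet
    have "t \<noteq> 0" "t \<noteq> 1" using meet v w by auto
    then have t: "0 < t" "t < 1" using meet by auto
    \<comment> \<open>now \<open>v\<close> is a negative multiple of \<open>w\<close>; pair both with the common image\<close>
    have "t *\<^sub>R v = - ((1 - t) *\<^sub>R w)" using meet(3) by (simp add: algebra_simps)
    then have "t * (v \<bullet> \<L> w) = - ((1 - t) * (w \<bullet> \<L> w))"
      by (metis inner_minus_left inner_scaleR_left)
    moreover have "t * (v \<bullet> \<L> w) > 0" "(1 - t) * (w \<bullet> \<L> w) > 0"
      using t inner_legendre_self[OF v] inner_legendre_self[OF w] positive[OF v] positive[OF w] eq by auto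
    ultimately show False by simp
  qed
qed

text \<open>The dual norm of \<open>p\<close> is the maximum of \<open>(p \<bullet> v) / f v\<close>, which is attained on the unit sphere and hence,
  by homogeneity, over all directions. At a maximum point \<open>v\<close> the covector \<open>p\<close> is a positive multiple of the
  gradient of \<open>f\<close>, so it is the Legendre image of a positive multiple of \<open>v\<close>.\<close>

lemma legendre_surjective:
  assumes p: "p \<noteq> 0"
  obtains v where "v \<noteq> 0" "\<L> v = p"
proof -
  let ?m = "\<lambda>v. (p \<bullet> v) / f v"
  have diff_f: "f differentiable (at v)" if "v \<noteq> 0" for v
    using smooth_on_differentiable[OF smooth] that by auto
  have "continuous_on (sphere 0 1) f"
    by (intro continuous_at_imp_continuous_on ballI differentiable_imp_continuous_within diff_f) auto
  moreover have "f v \<noteq> 0" if "v \<in> sphere 0 1" for v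
  proof -
    have "v \<noteq> 0" using that by auto
    then show ?thesis using positive[of v] by simp
  qed
  ultimately have cont: "continuous_on (sphere 0 1) ?m"
    by (intro continuous_on_divide continuous_on_inner continuous_on_const continuous_on_id) auto
  have "axis undefined 1 \<in> sphere (0 :: real^'n) 1" by simp
  then have "sphere (0 :: real^'n) 1 \<noteq> {}" by blast
  then obtain v where v: "v \<in> sphere 0 1" and max: "\<And>w. w \<in> sphere 0 1 \<Longrightarrow> ?m w \<le> ?m v"
    using continuous_attains_sup[OF compact_sphere _ cont] by blast
  have v0: "v \<noteq> 0" using v by auto
  have le: "?m w \<le> ?m v" if w: "w \<noteq> 0" for w
  proof -
    have "?m w = ?m (inverse (norm w) *\<^sub>R w)"
      using w homogeneous[of "inverse (norm w)" w] by simp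
    also have "\<dots> \<le> ?m v" using w by (intro max) simp
    finally show ?thesis .
  qed
  let ?\<mu> = "?m v"
  have \<mu>: "?\<mu> > 0"
    using le[OF p] positive[OF p] p by (smt (verit) divide_pos_pos inner_gt_zero_iff)
  have "((\<lambda>w. ?\<mu> * f w - p \<bullet> w) has_derivative (\<lambda>u. ?\<mu> * dderiv f u v - p \<bullet> u)) (at v)"
    by (intro has_derivative_diff has_derivative_mult_right has_derivative_inner_right
        has_derivative_ident has_derivative_dderiv diff_f v0)
  moreover have "?\<mu> * f v - p \<bullet> v \<le> ?\<mu> * f w - p \<bullet> w" if "w \<in> - {0}" for w
  proof -
    have "p \<bullet> w \<le> ?\<mu> * f w" using le[of w] positive[of w] that by (simp add: pos_divide_le_eq)
    then show ?thesis using positive[OF v0] by simp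
  qed
  \<comment> \<open>\<open>v\<close> minimises \<open>\<mu> f - p\<close> on the punctured space, with minimum \<open>0\<close>\<close>
  ultimately have crit: "(\<lambda>u. ?\<mu> * dderiv f u v - p \<bullet> u) = (\<lambda>u. 0)"
    using differential_zero_maxmin[of v "- {0}" "\<lambda>w. ?\<mu> * f w - p \<bullet> w"] v0 open_punctured by blast
  have "u \<bullet> (f v *\<^sub>R p) = u \<bullet> (?\<mu> *\<^sub>R \<L> v)" for u
  proof -
    have "(\<phi> has_derivative (\<lambda>u. 2 * f v * dderiv f u v)) (at v)"
      using has_derivative_power[OF has_derivative_dderiv[OF diff_f[OF v0]], of 2]
      by (simp add: mult_ac)
    then have "u \<bullet> \<L> v = f v * dderiv f u v"
      using inner_legendre[OF v0, of u] dderiv_eqI[of \<phi> _ v u] by simp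
    moreover have "p \<bullet> u = ?\<mu> * dderiv f u v" using fun_cong[OF crit, of u] by simp
    ultimately show ?thesis by (simp add: inner_commute)
  qed
  then have "f v *\<^sub>R p = ?\<mu> *\<^sub>R \<L> v" using vector_eq_ldot by blast
  then have "inverse (f v) *\<^sub>R (f v *\<^sub>R p) = inverse (f v) *\<^sub>R (?\<mu> *\<^sub>R \<L> v)"
    by (rule arg_cong)
  then have "p = (?\<mu> / f v) *\<^sub>R \<L> v"
    using positive[OF v0] by (simp add: divide_inverse mult.commute)
  moreover have "?\<mu> / f v > 0" using \<mu> positive[OF v0] by (rule divide_pos_pos)
  ultimately have "\<L> ((?\<mu> / f v) *\<^sub>R v) = p" "(?\<mu> / f v) *\<^sub>R v \<noteq> 0"
    using legendre_scaleR[OF hessian v0] v0 by auto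
  then show ?thesis using that by blast
qed

lemma legendre_bij: "bij_betw \<L> (- {0}) (- {0})"
proof (rule bij_betw_imageI)
  show "inj_on \<L> (- {0})" using legendre_injective by (simp add: inj_on_def)
  have "p \<in> \<L> ` (- {0})" if "p \<noteq> 0" for p
    using legendre_surjective[OF that] by (metis ComplI imageI singletonD)
  then show "\<L> ` (- {0}) = - {0}" using legendre_nonzero by auto
qed

text \<open>The gradient of half the squared dual norm is the inverse \<open>q\<close> of the Legendre map, as in any Legendre
  duality: differentiating \<open>\<phi> \<circ> q\<close> and using \<open>T *v w = q w\<close> gives \<open>2 q w\<close>. A second differentiation shows that the
  dual fundamental matrix is the inverse matrix \<open>T\<close>.\<close>

lemma dual_hessian:
  assumes h: "\<And>v. v \<noteq> 0 \<Longrightarrow> h (\<L> v) = f v"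
  shows "homogeneous_hessian_metric (fundamental_matrix h)"
proof -
  define q where "q = inv_into (- {0}) \<L>"
  have img: "w \<in> \<L> ` (- {0})" if "w \<noteq> 0" for w
    using legendre_bij that by (simp add: bij_betw_def)
  \<comment> \<open>bijectivity of the Legendre map on nonzero vectors supplies the inverse\<close>
  interpret dual_hessian_metric S q
  proof
    show "homogeneous_hessian_metric S" by (rule hessian)
    show "q w \<noteq> 0" if "w \<noteq> 0" for w
      using inv_into_into[OF img[OF that]] by (simp add: q_def)
    show "\<L> (q w) = w" if "w \<noteq> 0" for w
      using f_inv_into_f[OF img[OF that]] by (simp add: q_def)
    show "q (\<L> v) = v" if "v \<noteq> 0" for v
      using inv_into_f_f[of \<L> "- {0}" v] legendre_bij that by (simp add: q_def bij_betw_def)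
  qed
  have grad: "((\<lambda>w. (h w)\<^sup>2) has_derivative (\<lambda>u. 2 * (u \<bullet> q w))) (at w)" if w: "w \<noteq> 0" for w
  proof -
    have "((\<lambda>w. \<phi> (q w)) has_derivative (\<lambda>u. dderiv \<phi> (T w *v u) (q w))) (at w)"
      by (rule has_derivative_compose[OF q_has_derivative[OF w] has_derivative_dderiv[OF diff_square(1)[OF q_nonzero[OF w]]]])
    moreover have "dderiv \<phi> (T w *v u) (q w) = 2 * (u \<bullet> q w)" for u
    proof -
      have "dderiv \<phi> (T w *v u) (q w) = 2 * ((T w *v u) \<bullet> w)"
        using inner_legendre[OF q_nonzero[OF w], of "T w *v u"] legendre_q[OF w] by simp
      also have "(T w *v u) \<bullet> w = u \<bullet> q w"
        using inner_matrix_symmetric[OF T_symmetric[OF w], of u w] T_mult[OF w] by simp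
      finally show ?thesis .
    qed
    ultimately have "((\<lambda>w. \<phi> (q w)) has_derivative (\<lambda>u. 2 * (u \<bullet> q w))) (at w)" by simp
    then show ?thesis
    proof (rule has_derivative_transform_within_open[OF _ open_punctured])
      show "\<phi> (q b) = (h b)\<^sup>2" if "b \<in> - {0}" for b
        using h[OF q_nonzero, of b] legendre_q[of b] that by simp
    qed (use w in simp)
  qed
  have "fundamental_matrix h w $ i $ j = T w $ i $ j" if w: "w \<noteq> 0" for w i j
  proof -
    have "((\<lambda>b. 2 * (axis j 1 \<bullet> q b)) has_derivative (\<lambda>u. 2 * (axis j 1 \<bullet> (T w *v u)))) (at w)"
      by (intro has_derivative_mult_right has_derivative_inner_right q_has_derivative w)
    then have "(dderiv (\<lambda>w. (h w)\<^sup>2) (axis j 1) has_derivative (\<lambda>u. 2 * (axis j 1 \<bullet> (T w *v u)))) (at w)"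
      by (rule has_derivative_transform_within_open[OF _ open_punctured]) (use w dderiv_eqI[OF grad] in auto)
    then have "fundamental_matrix h w $ i $ j = axis j 1 \<bullet> (T w *v axis i 1)"
      using dderiv_eqI by (simp add: fundamental_matrix_def) fastforce
    also have "\<dots> = T w $ i $ j"
      using inner_matrix_symmetric[OF T_symmetric[OF w], of "axis j 1" "axis i 1"]
      by (simp add: matrix_vector_mul_component inner_axis)
    finally show ?thesis .
  qed
  then have "T w = fundamental_matrix h w" if "w \<noteq> 0" for w using that by (simp add: vec_eq_iff)
  then show ?thesis by (rule homogeneous_hessian_metric_cong[OF dual_is_hessian])
qed

end

section \<open>Linear coordinates on the fibres\<close>

locale smooth_atlas =
  fixes M :: "'m topology" and A :: "('m, 'e::euclidean_space) chart set"
  assumes smooth_manifold: "smooth_manifold M A"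
begin

lemma chart:
  assumes "c \<in> A"
  shows "openin M (cdom c)" "open (cmap c ` cdom c)"
    "homeomorphic_map (subtopology M (cdom c)) (top_of_set (cmap c ` cdom c)) (cmap c)"
  using smooth_manifold assms unfolding smooth_manifold_def by blast+

lemma chart_inj: "c \<in> A \<Longrightarrow> inj_on (cmap c) (cdom c)"
  using homeomorphic_imp_injective_map[OF chart(3)] openin_subset[OF chart(1)]
  by (simp add: Int_absorb1)

lemma open_chart_image:
  assumes "c \<in> A" "openin M W" "W \<subseteq> cdom c"
  shows "open (cmap c ` W)"
proof -
  have "openin (subtopology M (cdom c)) W"
    using assms by (simp add: openin_open_subtopology[OF chart(1)])
  then have "openin (top_of_set (cmap c ` cdom c)) (cmap c ` W)"
    using homeomorphic_imp_open_map[OF chart(3)] assms(1) unfolding open_map_def by blast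
  then show ?thesis using chart(2)[OF assms(1)] openin_open_eq by blast
qed

lemma transition_cmap: "c \<in> A \<Longrightarrow> x \<in> cdom c \<Longrightarrow> transition c d (cmap c x) = cmap d x"
  by (simp add: transition_def chart_inj)

lemma transition_differentiable:
  assumes "c \<in> charts_at A x" "d \<in> charts_at A x"
  shows "transition c d differentiable (at (cmap c x))"
proof (rule smooth_on_differentiable)
  show "smooth_on (cmap c ` (cdom c \<inter> cdom d)) (transition c d)"
    using smooth_manifold assms unfolding smooth_manifold_def charts_at_def by blast
qed (use assms in \<open>auto simp: charts_at_def\<close>)

abbreviation jacobi where "jacobi x c d \<equiv> frechet_derivative (transition c d) (at (cmap c x))"

lemma linear_jacobi: "c \<in> charts_at A x \<Longrightarrow> d \<in> charts_at A x \<Longrightarrow> linear (jacobi x c d)"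
  by (rule linear_dderiv[OF transition_differentiable])

text \<open>The chain rule for \<open>transition c e = transition d e \<circ> transition c d\<close>, valid near \<open>cmap c x\<close> because chart maps
  are open.\<close>

lemma jacobi_cocycle:
  assumes c: "c \<in> charts_at A x" and d: "d \<in> charts_at A x" and e: "e \<in> charts_at A x"
  shows "jacobi x d e (jacobi x c d v) = jacobi x c e v"
proof -
  have x: "x \<in> cdom c" "x \<in> cdom d" "x \<in> cdom e" and A: "c \<in> A" "d \<in> A" "e \<in> A"
    using assms by (auto simp: charts_at_def)
  have "(transition d e has_derivative jacobi x d e) (at (transition c d (cmap c x)))"
    using has_derivative_dderiv[OF transition_differentiable[OF d e]] x A by (simp add: transition_cmap)
  from has_derivative_compose[OF has_derivative_dderiv[OF transition_differentiable[OF c d]] this]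
  have "((\<lambda>a. transition d e (transition c d a)) has_derivative (\<lambda>v. jacobi x d e (jacobi x c d v))) (at (cmap c x))" .
  then have "(transition c e has_derivative (\<lambda>v. jacobi x d e (jacobi x c d v))) (at (cmap c x))"
  proof (rule has_derivative_transform_within_open)
    show "open (cmap c ` (cdom c \<inter> cdom d \<inter> cdom e))"
      by (intro open_chart_image openin_Int chart(1) A) auto
    show "cmap c x \<in> cmap c ` (cdom c \<inter> cdom d \<inter> cdom e)" using x by auto
    show "transition d e (transition c d a) = transition c e a"
      if "a \<in> cmap c ` (cdom c \<inter> cdom d \<inter> cdom e)" for a
      using that A by (auto simp: transition_cmap)
  qed
  then show ?thesis by (simp add: dderiv_eqI)
qed

lemma jacobi_self:
  assumes c: "c \<in> charts_at A x"
  shows "jacobi x c c v = v"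
proof -
  have x: "x \<in> cdom c" and A: "c \<in> A" using assms by (auto simp: charts_at_def)
  have "(transition c c has_derivative (\<lambda>v. v)) (at (cmap c x))"
    by (rule has_derivative_transform_within_open[OF has_derivative_ident, of "cmap c ` cdom c"])
      (use x A chart(2) in \<open>auto simp: transition_cmap\<close>)
  then show ?thesis by (simp add: dderiv_eqI)
qed

lemma tangent_spaceD:
  "y \<in> tangent_space A x \<Longrightarrow> c \<in> charts_at A x \<Longrightarrow> d \<in> charts_at A x \<Longrightarrow> y d = jacobi x c d (y c)"
  unfolding tangent_space_def by blast

lemma tangent_space_zero: "y \<in> tangent_space A x \<Longrightarrow> c \<notin> charts_at A x \<Longrightarrow> y c = 0"
  unfolding tangent_space_def by blast

lemma tangent_space_eqI:
  assumes "y \<in> tangent_space A x" "y' \<in> tangent_space A x" "c \<in> charts_at A x" "y c = y' c"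
  shows "y = y'"
proof
  fix d
  show "y d = y' d"
  proof (cases "d \<in> charts_at A x")
    case True
    then show ?thesis using assms by (metis tangent_spaceD)
  next
    case False
    then show ?thesis using assms(1,2) by (simp add: tangent_space_zero)
  qed
qed

text \<open>The cocycle identity lets any prescribed component in one chart be propagated consistently to all charts.
  Thus \<open>tangent_of\<close> inverts a bijection, and does not return an arbitrary value.\<close>

lemma tangent_of:
  assumes c: "c \<in> charts_at A x"
  shows "tangent_of A x c v \<in> tangent_space A x" "tangent_of A x c v c = v"
proof -
  let ?y = "\<lambda>d. if d \<in> charts_at A x then jacobi x c d v else 0"
  have "?y \<in> tangent_space A x"
    unfolding tangent_space_def using c by (simp add: jacobi_cocycle)
  moreover have "?y c = v" using c jacobi_self by simp
  ultimately have "v \<in> (\<lambda>y. y c) ` tangent_space A x"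
    by (intro rev_image_eqI[of ?y]) simp_all
  then show "tangent_of A x c v \<in> tangent_space A x" "tangent_of A x c v c = v"
    unfolding tangent_of_def by (rule inv_into_into, rule f_inv_into_f[of v "\<lambda>y. y c"])
qed

lemma tangent_of_scaleR:
  assumes c: "c \<in> charts_at A x"
  shows "tangent_of A x c (t *\<^sub>R v) = (\<lambda>d. t *\<^sub>R tangent_of A x c v d)"
proof (rule tangent_space_eqI[OF tangent_of(1)[OF c] _ c])
  have 1: "t *\<^sub>R tangent_of A x c v e = jacobi x d e (t *\<^sub>R tangent_of A x c v d)"
    if "d \<in> charts_at A x" "e \<in> charts_at A x" for d e
    using tangent_spaceD[OF tangent_of(1)[OF c] that] linear_cmul[OF linear_jacobi[OF that]] by metis
  have 2: "tangent_of A x c v d = 0" if "d \<notin> charts_at A x" for d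
    using tangent_space_zero[OF tangent_of(1)[OF c] that] .
  show "(\<lambda>d. t *\<^sub>R tangent_of A x c v d) \<in> tangent_space A x"
    unfolding tangent_space_def mem_Collect_eq 
    by (intro conjI ballI allI impI) (erule (1) 1, simp add: 2)
qed (simp add: tangent_of[OF c])

text \<open>Covector components are propagated by the adjoint Jacobians, in the opposite direction.\<close>

lemma cotangent_of:
  assumes c: "c \<in> charts_at A x"
  shows "cotangent_of A x c w \<in> cotangent_space A x" "cotangent_of A x c w c = w"
proof -
  let ?p = "\<lambda>d. if d \<in> charts_at A x then adjoint (jacobi x d c) w else 0"
  have adj: "adjoint (jacobi x d c) w \<bullet> v = w \<bullet> jacobi x d c v" if "d \<in> charts_at A x" for d v
    using adjoint_works[OF linear_jacobi[OF that c]] by (simp add: inner_commute)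
  then have "?p \<in> cotangent_space A x"
    unfolding cotangent_space_def using c by (simp add: jacobi_cocycle)
  moreover have "?p c = w"
  proof -
    have "adjoint (jacobi x c c) w \<bullet> v = w \<bullet> v" for v using adj[OF c] jacobi_self[OF c] by simp
    then show ?thesis using c vector_eq_rdot by (simp, blast)
  qed
  ultimately have "w \<in> (\<lambda>p. p c) ` cotangent_space A x"
    by (intro rev_image_eqI[of ?p]) simp_all
  then show "cotangent_of A x c w \<in> cotangent_space A x" "cotangent_of A x c w c = w"
    unfolding cotangent_of_def by (rule inv_into_into, rule f_inv_into_f[of w "\<lambda>p. p c"])
qed

text \<open>The leaf may be presented in another chart. Nonvanishing of components is independent of the chart.\<close>

lemma vertical_leaf_nonzero:
  assumes L: "vertical_leaf M A L" and q: "(x, y, p) \<in> L" and c: "c \<in> charts_at A x"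
  shows "y c \<noteq> 0" "p c \<noteq> 0"
proof -
  obtain x' d C where d: "d \<in> charts_at A x'" and C: "C \<in> components ((- {0}) \<times> (- {0}))"
    and "L = {q \<in> {x'} \<times> tangent_space A x' \<times> cotangent_space A x'. fibre_coords d q \<in> C}"
    using L unfolding vertical_leaf_def by blast
  then have x': "x' = x" and y: "y \<in> tangent_space A x" and p: "p \<in> cotangent_space A x"
    and "(y d, p d) \<in> C" using q by auto
  then have nz: "y d \<noteq> 0" "p d \<noteq> 0" using in_components_subset[OF C] by auto
  note d = d[unfolded x']
  show "y c \<noteq> 0"
    using nz(1) tangent_spaceD[OF y c d] linear_0[OF linear_jacobi[OF c d]] by auto
  have "p d \<bullet> v = p c \<bullet> jacobi x d c v" for v
    using p c d unfolding cotangent_space_def by blast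
  then have "p d \<bullet> p d = p c \<bullet> jacobi x d c (p d)" .
  then show "p c \<noteq> 0" using nz(2) by auto
qed

end

lemma minkowski_norm_fibre:
  fixes A :: "('m, real^'n) chart set"
  assumes M: "smooth_manifold M A" and F: "finsler_structure M A F"
    and x: "x \<in> topspace M" and c: "c \<in> charts_at A x"
  shows "minkowski_norm (\<lambda>v. F x (tangent_of A x c v))"
proof -
  interpret smooth_atlas M A by (rule smooth_atlas.intro[OF M])
  have cx: "c \<in> A" "x \<in> cdom c" using c by (auto simp: charts_at_def)
  show ?thesis
  proof
    let ?\<Phi> = "\<lambda>(a, v). let x = inv_into (cdom c) (cmap c) a in F x (tangent_of A x c v)"
    have "smooth_on ((cmap c ` cdom c) \<times> (- {0})) ?\<Phi>"
      using F cx unfolding finsler_structure_def by blast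
    then have "Ck_on k (- {0}) (\<lambda>v. ?\<Phi> (cmap c x, v))" for k
      using cx unfolding smooth_on_def by (intro Ck_on_slice[where S = "cmap c ` cdom c"]) (auto simp: open_Compl)
    then show "smooth_on (- {0}) (\<lambda>v. F x (tangent_of A x c v))"
      using chart_inj cx by (simp add: smooth_on_def)
    show "0 \<le> F x (tangent_of A x c v)" for v
      using F x tangent_of(1)[OF c] unfolding finsler_structure_def by blast
    show "F x (tangent_of A x c (t *\<^sub>R v)) = t * F x (tangent_of A x c v)" if "t > 0" for t v
      using F x tangent_of(1)[OF c, of v] that unfolding finsler_structure_def tangent_of_scaleR[OF c] by blast
    show "u \<bullet> (fundamental_matrix (\<lambda>v. F x (tangent_of A x c v)) v *v u) > 0" if "v \<noteq> 0" "u \<noteq> 0" for u v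
      using F x c that unfolding finsler_structure_def g_lower_def by blast
  qed
qed

text \<open>This is how \<open>K\<close> enters the proof. The duality is prescribed on nonzero vectors; \<open>tangent_of A x c v\<close>
  is one of them because its component in \<open>c\<close> is \<open>v\<close>.\<close>

lemma dual_cartan_legendre:
  fixes A :: "('m, real^'n) chart set"
  assumes M: "smooth_manifold M A" and K: "dual_cartan_structure M A F K"
    and x: "x \<in> topspace M" and c: "c \<in> charts_at A x" and v: "v \<noteq> 0"
  shows "K x (cotangent_of A x c (legendre (g_lower A F c x) v)) = F x (tangent_of A x c v)"
proof -
  interpret smooth_atlas M A by (rule smooth_atlas.intro[OF M])
  have "tangent_of A x c v \<noteq> (\<lambda>_. 0)" using tangent_of(2)[OF c, of v] v by auto
  moreover have "cotangent_of A x c (legendre (g_lower A F c x) v) c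
      = g_lower A F c x (tangent_of A x c v c) *v tangent_of A x c v c"
    by (simp add: tangent_of(2)[OF c] cotangent_of(2)[OF c] legendre_def)
  ultimately show ?thesis
    using K x c tangent_of(1)[OF c] cotangent_of(1)[OF c] unfolding dual_cartan_structure_def by blast
qed

theorem theorem2p3:
  fixes M :: "'m topology"
    and A :: "('m, real^'n) chart set"
    and F K :: "'m \<Rightarrow> ('m, real^'n) components \<Rightarrow> real"
    and L :: "('m, real^'n) big_tangent set"
    and x :: 'm
    and y p :: "('m, real^'n) components"
    and c :: "('m, real^'n) chart"
    and P :: "((real^'n) \<times> (real^'n)) set"
  assumes "smooth_manifold M A"
    and "finsler_structure M A F"
    and "dual_cartan_structure M A F K"
    and "vertical_leaf M A L"
    and "(x, y, p) \<in> L"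
    and "c \<in> charts_at A x"
    and "plane_section P"
    and "nondegenerate_plane (leaf_metric A F K c x) (fibre_coords c (x, y, p)) P"
    and "vertical_liouville c (x, y, p) \<in> P"
  shows "sectional_curvature (leaf_metric A F K c x) (fibre_coords c (x, y, p)) P = 0"
proof -
  interpret smooth_atlas M A by (rule smooth_atlas.intro) fact
  have x: "x \<in> topspace M"
    using assms(6) openin_subset[OF chart(1), of c] by (auto simp: charts_at_def)
  interpret minkowski_norm "\<lambda>v. F x (tangent_of A x c v)"
    by (rule minkowski_norm_fibre[OF assms(1,2) x assms(6)])
  have g: "homogeneous_hessian_metric (g_lower A F c x)"
    using hessian unfolding g_lower_def .
  have g': "homogeneous_hessian_metric (g_star A K c x)"
    unfolding g_star_def
    by (rule dual_hessian) (use dual_cartan_legendre[OF assms(1,3) x assms(6)] in \<open>simp add: g_lower_def\<close>)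
  have metric: "leaf_metric A F K c x = block_metric (g_lower A F c x) (g_star A K c x)"
    by (auto simp: fun_eq_iff)
  show ?thesis
    unfolding metric
    by (rule sectional_curvature_block_metric[OF g g' _ _ assms(7)])
      (use vertical_leaf_nonzero[OF assms(4-6)] assms(9) in simp_all)
qed

end
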